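(* Consider the equation $$(1-\tau)du(t)=t$$ for continuous $\mathbf F_q$-linear functions $u:O_\pi\to\Omega_\pi$. This equation has exactly $q^\delta$ continuous ($\mathbf F_q$-linear) solutions on $O_\pi$ coinciding with the function $$\sum_{n=1}^\infty \frac{t^{q^n}}{[n]}$$ for $|t|_\pi\le q^{-\delta}$. These solutions have the expansions in the normalized Carlitz polynomials $$u=\sum_{i=0}^\infty c_if_i,$$ where the coefficients $c_1,\ldots,c_\delta\in\Omega_\pi$ are arbitrary solutions of the equations $$c_1^q-c_1+1=0,$$ $$c_{i+1}^q-c_{i+1}+[i]^qc_i^q=0,\quad 1\le i\le\delta-1,$$ the higher coefficients are found from the relations $$c_n=\sum_{j=0}^\infty\left(c_{n-1}[n-1]\right)^{q^{j+1}},\quad n\ge\delta+1,$$ and the coefficient $c_0$ is determined by the relation $$c_0=\sum_{i=1}^\infty(-1)^{i+1}\frac{c_i}{L_i}.$$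
   Context: Let $\mathbf F_q$ be the finite field with $q$ elements, of characteristic $\varkappa$, and let $\pi\in\mathbf F_q[x]$ be a monic irreducible polynomial of degree $\delta$. Let $|\cdot|_\pi$ be the $\pi$-adic absolute value on $\mathbf F_q(x)$ normalized by $|\pi|_\pi=q^{-\delta}$, $K_\pi$ the completion of $\mathbf F_q(x)$ with respect to it, $\Omega_\pi$ the completion of an algebraic closure of $K_\pi$ (with the canonically extended absolute value), and $O_\pi=\{t\in K_\pi:\ |t|_\pi\le1\}$. All variables $t$ lie in $K_\pi$. A function $f$ on an $\mathbf F_q$-subspace of $K_\pi$ with values in $\Omega_\pi$ is $\mathbf F_q$-linear if $f(t_1+t_2)=f(t_1)+f(t_2)$ and $f(\alpha t)=\alpha f(t)$ for all $t,t_1,t_2$ in the subspace and $\alpha\in\mathbf F_q$. Throughout, the unknown functions in the equations are $\mathbf F_q$-linear. Operators: $(\Delta u)(t)=u(xt)-xu(t)$; $(du)(t)=\big((\Delta u)(t)\big)^{1/q}$ (the unique $q$-th root in $\Omega_\pi$); $\tau u=u^q$, i.e. $(\tau u)(t)=u(t)^q$. (Thus the equation $(1-\tau)du(t)=t$ means $du(t)-\Delta u(t)=t$.) Notation: $[n]=x^{q^n}-x$ for $n\ge1$; $L_i=[i][i-1]\cdots[1]$ for $i\ge1$; $D_0=1$, $D_i=[i][i-1]^q\cdots[1]^{q^{i-1}}$; $e_0(t)=t$, $e_i(t)=\prod_{\omega\in\mathbf F_q[x],\ \deg\omega<i}(t-\omega)$ for $i\ge1$ (the product including $\omega=0$); the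 normalized Carlitz polynomials are $f_i(t)=D_i^{-1}e_i(t)$, $i\ge0$. The sequence $\{f_i\}$ is an orthonormal basis of the space of continuous $\mathbf F_q$-linear functions $O_\pi\to\Omega_\pi$. The series $\sum_{n\ge1}t^{q^n}/[n]$ converges for $|t|_\pi\le q^{-\delta}$. *)

theory Defs
  imports "HOL-Analysis.Analysis" "HOL-Computational_Algebra.Computational_Algebra"
begin

(* Not real_normed_field: that class forces characteristic zero, and the library's norm carries
   the sort constraint real_normed_vector, hence the separate constant absv. *)
class valued_field = field + metric_space +
  fixes absv :: "'a \<Rightarrow> real"
  assumes dist_absv: "dist x y = absv (x - y)"
    and absv_mult: "absv (x * y) = absv x * absv y"
    and absv_add_le_max: "absv (x + y) \<le> max (absv x) (absv y)"

class complete_valued_field = valued_field + complete_space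

(* The library's multiplicity is not available here: it requires a normalization and a gcd on
   'a poly, hence a sort constraint on 'a beyond field. *)
definition pi_val :: "'a::field poly \<Rightarrow> 'a poly \<Rightarrow> nat" where
  "pi_val \<pi> a = (GREATEST n. \<pi> ^ n dvd a)"

definition poly_pi_abs :: "'a::{field,finite} poly \<Rightarrow> 'a poly \<Rightarrow> real" where
  "poly_pi_abs \<pi> a = (if a = 0 then 0 else (1 / real CARD('a) ^ degree \<pi>) ^ pi_val \<pi> a)"

(* Independent of the chosen fraction when \<pi> is irreducible: lemma pi_abs_Fract. *)
definition pi_abs :: "'a::{field,finite} poly \<Rightarrow> 'a poly fract \<Rightarrow> real" where
  "pi_abs \<pi> r =
     (let (a, b) = (SOME (a, b). b \<noteq> 0 \<and> r = Fract a b) in poly_pi_abs \<pi> a / poly_pi_abs \<pi> b)"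

lemma pi_val_decompose:
  fixes \<pi> :: "'a::field poly"
  assumes "irreducible \<pi>" and "a \<noteq> 0"
  obtains b where "a = \<pi> ^ pi_val \<pi> a * b" and "\<not> \<pi> dvd b"
proof -
  have "\<pi> \<noteq> 0" and "\<not> is_unit \<pi>" using assms(1) by (auto simp: irreducible_def)
  hence deg: "degree \<pi> > 0" by (simp add: is_unit_iff_degree)
  have bound: "n \<le> degree a" if "\<pi> ^ n dvd a" for n
  proof -
    have "n * 1 \<le> n * degree \<pi>" using deg by (intro mult_le_mono2) simp
    also have "\<dots> = degree (\<pi> ^ n)" using \<open>\<pi> \<noteq> 0\<close> by (simp add: degree_power_eq)
    also have "\<dots> \<le> degree a" by (rule dvd_imp_degree_le[OF that assms(2)])
    finally show ?thesis by simp
  qed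
  have "\<pi> ^ pi_val \<pi> a dvd a" unfolding pi_val_def
    by (rule GreatestI_nat[of _ 0 "degree a"]) (use bound in auto)
  then obtain b where b: "a = \<pi> ^ pi_val \<pi> a * b" by (elim dvdE)
  have "\<not> \<pi> dvd b"
  proof
    assume "\<pi> dvd b"
    then obtain c where "b = \<pi> * c" by (elim dvdE)
    hence "a = \<pi> ^ Suc (pi_val \<pi> a) * c" using b by (simp add: mult_ac)
    hence "\<pi> ^ Suc (pi_val \<pi> a) dvd a" by (metis dvd_triv_left)
    hence "Suc (pi_val \<pi> a) \<le> (GREATEST n. \<pi> ^ n dvd a)"
      by (rule Greatest_le_nat) (use bound in auto)
    thus False by (simp add: pi_val_def)
  qed
  with b show thesis by (rule that)
qed

lemma pi_val_eqI:
  fixes \<pi> :: "'a::field poly"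
  assumes "\<pi> \<noteq> 0" and "\<not> \<pi> dvd b"
  shows "pi_val \<pi> (\<pi> ^ n * b) = n"
  unfolding pi_val_def
proof (rule Greatest_equality)
  fix m assume dvd: "\<pi> ^ m dvd \<pi> ^ n * b"
  show "m \<le> n"
  proof (rule ccontr)
    assume "\<not> m \<le> n"
    hence "\<pi> ^ Suc n dvd \<pi> ^ n * b" by (intro dvd_trans[OF le_imp_power_dvd dvd]) simp
    hence "\<pi> ^ n * \<pi> dvd \<pi> ^ n * b" by (simp add: mult.commute)
    thus False using assms by simp
  qed
qed simp

lemma pi_val_mult:
  fixes \<pi> :: "'a::field poly"
  assumes irr: "irreducible \<pi>" and "a \<noteq> 0" "b \<noteq> 0"
  shows "pi_val \<pi> (a * b) = pi_val \<pi> a + pi_val \<pi> b"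
proof -
  have "prime_elem \<pi>" using irr by (rule field_poly_irreducible_imp_prime)
  obtain c where c: "a = \<pi> ^ pi_val \<pi> a * c" "\<not> \<pi> dvd c"
    using pi_val_decompose[OF irr \<open>a \<noteq> 0\<close>] .
  obtain d where d: "b = \<pi> ^ pi_val \<pi> b * d" "\<not> \<pi> dvd d"
    using pi_val_decompose[OF irr \<open>b \<noteq> 0\<close>] .
  have "a * b = \<pi> ^ pi_val \<pi> a * c * (\<pi> ^ pi_val \<pi> b * d)"
    using c(1) d(1) by (rule arg_cong2)
  hence eq: "a * b = \<pi> ^ (pi_val \<pi> a + pi_val \<pi> b) * (c * d)"
    by (simp only: power_add mult_ac)
  have "\<not> \<pi> dvd c * d"
    using c(2) d(2) \<open>prime_elem \<pi>\<close> by (simp add: prime_elem_dvd_mult_iff)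
  thus ?thesis using irr by (subst eq) (auto intro!: pi_val_eqI)
qed

lemma poly_pi_abs_mult:
  fixes \<pi> :: "'a::{field,finite} poly"
  assumes "irreducible \<pi>"
  shows "poly_pi_abs \<pi> (a * b) = poly_pi_abs \<pi> a * poly_pi_abs \<pi> b"
  using assms by (simp add: poly_pi_abs_def pi_val_mult power_add)

lemma poly_pi_abs_eq_0_iff: "poly_pi_abs \<pi> a = 0 \<longleftrightarrow> a = 0"
  by (simp add: poly_pi_abs_def)

lemma pi_abs_Fract:
  fixes \<pi> :: "'a::{field,finite} poly"
  assumes "irreducible \<pi>" and "b \<noteq> 0"
  shows "pi_abs \<pi> (Fract a b) = poly_pi_abs \<pi> a / poly_pi_abs \<pi> b"
proof -
  obtain c d where cd: "(SOME (c, d). d \<noteq> 0 \<and> Fract a b = Fract c d) = (c, d)"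
    by (meson surj_pair)
  have "case (SOME (c, d). d \<noteq> 0 \<and> Fract a b = Fract c d) of
      (c, d) \<Rightarrow> d \<noteq> 0 \<and> Fract a b = Fract c d"
    by (rule someI[of _ "(a, b)"]) (use assms(2) in simp)
  hence d: "d \<noteq> 0" and "Fract a b = Fract c d" by (simp_all add: cd)
  hence "a * d = c * b" using assms(2) by (simp add: eq_fract)
  hence "poly_pi_abs \<pi> a * poly_pi_abs \<pi> d = poly_pi_abs \<pi> c * poly_pi_abs \<pi> b"
    by (metis poly_pi_abs_mult[OF assms(1)])
  thus ?thesis using d assms(2)
    by (simp add: pi_abs_def cd frac_eq_eq poly_pi_abs_eq_0_iff)
qed

(* Completions and closures are taken inside the complete field 'w: the completion of the image of
   F_q(x) is its topological closure. *)
definition K_pi :: "('a::{field,finite} poly fract \<Rightarrow> 'w::valued_field) \<Rightarrow> 'w set" where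
  "K_pi \<iota> = closure (range \<iota>)"

definition algebraic_elements :: "'w::field set \<Rightarrow> 'w set" where
  "algebraic_elements K = {z. \<exists>p. p \<noteq> 0 \<and> (\<forall>n. coeff p n \<in> K) \<and> poly p z = 0}"

(* 'w, together with the embedding \<iota> of F_q(x), is the completion of an algebraic closure of K_pi:
   \<iota> is an isometric field embedding, the elements algebraic over K_pi form an algebraically closed
   field, and this field is dense in the complete field 'w. Since K_pi is complete, absv restricted
   to the algebraic closure is the unique extension of the absolute value of K_pi. These conditions
   determine 'w up to isometric isomorphism over F_q(x). *)
locale is_Omega_pi =
  fixes \<pi> :: "'a::{field,finite} poly"
    and \<iota> :: "'a poly fract \<Rightarrow> 'w::complete_valued_field"
  assumes emb_one: "\<iota> 1 = 1"
    and emb_add: "\<iota> (r + s) = \<iota> r + \<iota> s"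
    and emb_mult: "\<iota> (r * s) = \<iota> r * \<iota> s"
    and emb_absv: "absv (\<iota> r) = pi_abs \<pi> r"
    and alg_closed: "\<lbrakk>\<And>n. coeff p n \<in> algebraic_elements (K_pi \<iota>); degree p > 0\<rbrakk> \<Longrightarrow>
          \<exists>z \<in> algebraic_elements (K_pi \<iota>). poly p z = 0"
    and dense: "closure (algebraic_elements (K_pi \<iota>)) = UNIV"

definition O_pi :: "('a::{field,finite} poly fract \<Rightarrow> 'w::valued_field) \<Rightarrow> 'w set" where
  "O_pi \<iota> = {t \<in> K_pi \<iota>. absv t \<le> 1}"

definition emb_poly :: "('a::{field,finite} poly fract \<Rightarrow> 'w::field) \<Rightarrow> 'a poly \<Rightarrow> 'w" where
  "emb_poly \<iota> p = \<iota> (Fract p 1)"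

definition var_x :: "('a::{field,finite} poly fract \<Rightarrow> 'w::field) \<Rightarrow> 'w" where
  "var_x \<iota> = emb_poly \<iota> [:0, 1:]"

definition Fq_linear_on ::
    "('a::{field,finite} poly fract \<Rightarrow> 'w::field) \<Rightarrow> 'w set \<Rightarrow> ('w \<Rightarrow> 'w) \<Rightarrow> bool" where
  "Fq_linear_on \<iota> V f \<longleftrightarrow>
     (\<forall>s\<in>V. \<forall>t\<in>V. f (s + t) = f s + f t) \<and>
     (\<forall>\<alpha>. \<forall>t\<in>V. f (emb_poly \<iota> [:\<alpha>:] * t) = emb_poly \<iota> [:\<alpha>:] * f t)"

definition Delta :: "('a::{field,finite} poly fract \<Rightarrow> 'w::field) \<Rightarrow> ('w \<Rightarrow> 'w) \<Rightarrow> 'w \<Rightarrow> 'w" where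
  "Delta \<iota> u t = u (var_x \<iota> * t) - var_x \<iota> * u t"

definition carlitz_d :: "('a::{field,finite} poly fract \<Rightarrow> 'w::field) \<Rightarrow> ('w \<Rightarrow> 'w) \<Rightarrow> 'w \<Rightarrow> 'w" where
  "carlitz_d \<iota> u t = (THE z. z ^ CARD('a) = Delta \<iota> u t)"

definition tau :: "('a::{field,finite} poly fract \<Rightarrow> 'w::field) \<Rightarrow> ('w \<Rightarrow> 'w) \<Rightarrow> 'w \<Rightarrow> 'w" where
  "tau \<iota> u t = u t ^ CARD('a)"

definition bracket :: "('a::{field,finite} poly fract \<Rightarrow> 'w::field) \<Rightarrow> nat \<Rightarrow> 'w" where
  "bracket \<iota> n = var_x \<iota> ^ (CARD('a) ^ n) - var_x \<iota>"

definition carlitz_L :: "('a::{field,finite} poly fract \<Rightarrow> 'w::field) \<Rightarrow> nat \<Rightarrow> 'w" where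
  "carlitz_L \<iota> i = (\<Prod>j = 1..i. bracket \<iota> j)"

definition carlitz_D :: "('a::{field,finite} poly fract \<Rightarrow> 'w::field) \<Rightarrow> nat \<Rightarrow> 'w" where
  "carlitz_D \<iota> i = (\<Prod>j = 1..i. bracket \<iota> j ^ (CARD('a) ^ (i - j)))"

(* In the second branch the zero polynomial is included, its degree being 0. *)
definition carlitz_e :: "('a::{field,finite} poly fract \<Rightarrow> 'w::field) \<Rightarrow> nat \<Rightarrow> 'w \<Rightarrow> 'w" where
  "carlitz_e \<iota> i t =
     (if i = 0 then t else (\<Prod>\<omega> \<in> {\<omega> :: 'a poly. degree \<omega> < i}. t - emb_poly \<iota> \<omega>))"

definition carlitz_f :: "('a::{field,finite} poly fract \<Rightarrow> 'w::field) \<Rightarrow> nat \<Rightarrow> 'w \<Rightarrow> 'w" where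
  "carlitz_f \<iota> i t = carlitz_e \<iota> i t / carlitz_D \<iota> i"

(* A function on O_pi is represented by its extensional (undefined outside O_pi) version, so that
   the solutions can be counted. *)
definition solutions ::
    "'a::{field,finite} poly \<Rightarrow> ('a poly fract \<Rightarrow> 'w::complete_valued_field) \<Rightarrow> ('w \<Rightarrow> 'w) set" where
  "solutions \<pi> \<iota> =
     {u \<in> O_pi \<iota> \<rightarrow>\<^sub>E UNIV.
        continuous_on (O_pi \<iota>) u \<and> Fq_linear_on \<iota> (O_pi \<iota>) u \<and>
        (\<forall>t \<in> O_pi \<iota>. carlitz_d \<iota> u t - tau \<iota> (carlitz_d \<iota> u) t = t) \<and>
        (\<forall>t \<in> K_pi \<iota>. absv t \<le> 1 / real CARD('a) ^ degree \<pi> \<longrightarrow>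
           (\<lambda>n. t ^ (CARD('a) ^ Suc n) / bracket \<iota> (Suc n)) sums u t)}"

(* Expansion in the orthonormal basis (f_i): convergence in the supremum norm on O_pi. *)
definition carlitz_expansion ::
    "('a::{field,finite} poly fract \<Rightarrow> 'w::valued_field) \<Rightarrow> (nat \<Rightarrow> 'w) \<Rightarrow> ('w \<Rightarrow> 'w) \<Rightarrow> bool" where
  "carlitz_expansion \<iota> c u \<longleftrightarrow>
     uniform_limit (O_pi \<iota>) (\<lambda>N t. \<Sum>i<N. c i * carlitz_f \<iota> i t) u sequentially"

definition initial_relations ::
    "'a::{field,finite} poly \<Rightarrow> ('a poly fract \<Rightarrow> 'w::field) \<Rightarrow> (nat \<Rightarrow> 'w) \<Rightarrow> bool" where
  "initial_relations \<pi> \<iota> c \<longleftrightarrow>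
     c 1 ^ CARD('a) - c 1 + 1 = 0 \<and>
     (\<forall>i. 1 \<le> i \<and> i \<le> degree \<pi> - 1 \<longrightarrow>
        c (i + 1) ^ CARD('a) - c (i + 1) + bracket \<iota> i ^ CARD('a) * c i ^ CARD('a) = 0)"

definition higher_relations ::
    "'a::{field,finite} poly \<Rightarrow> ('a poly fract \<Rightarrow> 'w::valued_field) \<Rightarrow> (nat \<Rightarrow> 'w) \<Rightarrow> bool" where
  "higher_relations \<pi> \<iota> c \<longleftrightarrow>
     (\<forall>n \<ge> degree \<pi> + 1.
        (\<lambda>j. (c (n - 1) * bracket \<iota> (n - 1)) ^ (CARD('a) ^ (j + 1))) sums c n)"

definition zeroth_relation ::
    "('a::{field,finite} poly fract \<Rightarrow> 'w::valued_field) \<Rightarrow> (nat \<Rightarrow> 'w) \<Rightarrow> bool" where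
  "zeroth_relation \<iota> c \<longleftrightarrow>
     (\<lambda>i. (- 1) ^ (Suc i + 1) * (c (Suc i) / carlitz_L \<iota> (Suc i))) sums c 0"

end

theory Submission
  imports Defs
begin

text \<open>For \<open>w = \<Delta>u\<close> the equation says \<open>w(t)\<^sup>q - w(t) + t\<^sup>q = 0\<close>. Two solutions with the same values
  \<open>w(1), \<dots>, w(x\<^bsup>\<delta>-1\<^esup>)\<close> agree, because a solution is prescribed on \<open>\<pi>O\<close> and \<open>u(\<pi>)\<close> fixes \<open>u(1)\<close>;
  each of these \<open>\<delta>\<close> values is a root of an Artin-Schreier polynomial of degree \<open>q\<close>, so there are at
  most \<open>q\<^sup>\<delta>\<close> solutions.

  Conversely \<open>\<Delta>f\<^sub>i = f\<^bsub>i-1\<^esub>\<^sup>q\<close> and \<open>f\<^sub>i\<^sup>q = f\<^sub>i + [i+1] f\<^bsub>i+1\<^esub>\<close> make the coefficient relations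
  equivalent to the equation, term by term, so that the \<open>q\<^sup>\<delta>\<close> tuples of initial coefficients give
  series \<open>\<Sum> c\<^sub>i f\<^sub>i\<close> satisfying it. They are pairwise distinct since \<open>f\<^sub>i(x\<^sup>k)\<close> is unitriangular, and
  they have the prescribed values on \<open>\<pi>O\<close>: there \<open>|w| < 1\<close>, which leaves only the root
  \<open>w(t) = \<Sum> t\<^bsup>q^n\<^esup>\<close>, and the relation for \<open>c\<^sub>0\<close> expresses that the derivative at 0 vanishes.
  Counting shows that these are all solutions.\<close>

subsection \<open>Ultrametric absolute values\<close>

context valued_field
begin

lemma absv_0 [simp]: "absv 0 = 0"
  using dist_absv[of 0 0] by simp

lemma absv_nonneg [simp]: "0 \<le> absv x"
  using dist_absv[of x 0] zero_le_dist[of x 0] by simp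

lemma absv_eq_0_iff [simp]: "absv x = 0 \<longleftrightarrow> x = 0"
  using dist_absv[of x 0] dist_eq_0_iff[of x 0] by simp

lemma absv_pos_iff [simp]: "0 < absv x \<longleftrightarrow> x \<noteq> 0"
  using absv_nonneg[of x] absv_eq_0_iff[of x] by linarith

lemma absv_1 [simp]: "absv 1 = 1"
  using absv_mult[of 1 1] by simp

lemma absv_minus [simp]: "absv (- x) = absv x"
  using dist_absv[of x 0] dist_absv[of 0 x] dist_commute[of x 0] by simp

lemma absv_minus_commute: "absv (x - y) = absv (y - x)"
  using absv_minus[of "x - y"] by simp

lemma absv_diff_le_max: "absv (x - y) \<le> max (absv x) (absv y)"
  using absv_add_le_max[of x "- y"] by simp

lemma absv_add_le: "absv x \<le> B \<Longrightarrow> absv y \<le> B \<Longrightarrow> absv (x + y) \<le> B"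
  using absv_add_le_max[of x y] by linarith

lemma absv_diff_le: "absv x \<le> B \<Longrightarrow> absv y \<le> B \<Longrightarrow> absv (x - y) \<le> B"
  using absv_diff_le_max[of x y] by linarith

lemma absv_power: "absv (x ^ n) = absv x ^ n"
  by (induction n) (simp_all add: absv_mult)

lemma absv_prod: "absv (prod f A) = (\<Prod>i\<in>A. absv (f i))"
  by (induction A rule: infinite_finite_induct) (simp_all add: absv_mult)

lemma absv_sum_le:
  assumes "\<And>i. i \<in> A \<Longrightarrow> absv (f i) \<le> B" and "0 \<le> B"
  shows "absv (sum f A) \<le> B"
  using assms
  by (induction A rule: infinite_finite_induct) (auto intro: absv_add_le)

end

lemma absv_inverse:
  fixes x :: "'w::valued_field"
  shows "absv (inverse x) = inverse (absv x)"
proof (cases "x = 0")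
  case False
  then have "absv x * absv (inverse x) = 1"
    by (simp flip: absv_mult)
  then show ?thesis by (metis inverse_unique)
qed simp

lemma absv_divide:
  fixes x :: "'w::valued_field"
  shows "absv (x / y) = absv x / absv y"
  by (simp add: divide_inverse absv_mult absv_inverse)

lemma tendsto_iff_absv_diff:
  fixes f :: "'b \<Rightarrow> 'w::valued_field"
  shows "(f \<longlongrightarrow> l) F \<longleftrightarrow> ((\<lambda>n. absv (f n - l)) \<longlongrightarrow> 0) F"
  by (subst tendsto_dist_iff) (simp add: dist_absv)

lemma tendsto_absv:
  fixes f :: "'b \<Rightarrow> 'w::valued_field"
  assumes "(f \<longlongrightarrow> l) F"
  shows "((\<lambda>n. absv (f n)) \<longlongrightarrow> absv l) F"
  using tendsto_dist[OF assms tendsto_const[of 0]] by (simp add: dist_absv)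

lemma tendsto_absv_le:
  fixes f :: "nat \<Rightarrow> 'w::valued_field"
  assumes "f \<longlonglongrightarrow> l" and "\<And>n. absv (f n) \<le> B"
  shows "absv l \<le> B"
  using tendsto_absv[OF assms(1)] assms(2) by (intro LIMSEQ_le_const2) auto

lemma tendsto_absv_diffI:
  fixes f :: "'b \<Rightarrow> 'w::valued_field"
  assumes "(g \<longlongrightarrow> 0) F" and "\<And>n. absv (f n - l) \<le> g n"
  shows "(f \<longlongrightarrow> l) F"
  unfolding tendsto_iff_absv_diff
  by (rule tendsto_sandwich[OF _ _ tendsto_const assms(1)]) (use assms(2) in auto)

instance valued_field \<subseteq> topological_ab_group_add
proof
  fix a b :: 'a
  let ?F = "nhds a \<times>\<^sub>F nhds b"
  have a: "((\<lambda>z. absv (fst z - a)) \<longlongrightarrow> 0) ?F" and b: "((\<lambda>z. absv (snd z - b)) \<longlongrightarrow> 0) ?F"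
    by (simp_all flip: tendsto_iff_absv_diff add: filterlim_fst filterlim_snd)
  show "LIM x ?F. fst x + snd x :> nhds (a + b)"
  proof (rule tendsto_absv_diffI)
    show "((\<lambda>z. max (absv (fst z - a)) (absv (snd z - b))) \<longlongrightarrow> 0) ?F"
      using tendsto_max[OF a b] by simp
    show "absv (fst z + snd z - (a + b)) \<le> max (absv (fst z - a)) (absv (snd z - b))" for z
      using absv_add_le_max[of "fst z - a" "snd z - b"] by (simp add: algebra_simps)
  qed
  show "(uminus \<longlongrightarrow> - a) (nhds a)"
  proof (rule tendsto_absv_diffI)
    show "((\<lambda>z. absv (z - a)) \<longlongrightarrow> 0) (nhds a)"
      by (simp flip: tendsto_iff_absv_diff add: filterlim_ident)
    show "absv (- z - - a) \<le> absv (z - a)" for z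
      using absv_minus_commute[of z a] by simp
  qed
qed

instance valued_field \<subseteq> topological_semigroup_mult
proof
  fix a b :: 'a
  let ?F = "nhds a \<times>\<^sub>F nhds b"
  have a: "((\<lambda>z. absv (fst z - a)) \<longlongrightarrow> 0) ?F" and b: "((\<lambda>z. absv (snd z - b)) \<longlongrightarrow> 0) ?F"
    by (simp_all flip: tendsto_iff_absv_diff add: filterlim_fst filterlim_snd)
  show "LIM x ?F. fst x * snd x :> nhds (a * b)"
  proof (rule tendsto_absv_diffI)
    let ?g = "\<lambda>z. max (absv (fst z - a) * absv (snd z - b))
        (max (absv a * absv (snd z - b)) (absv (fst z - a) * absv b))"
    have "(?g \<longlongrightarrow> max (0 * 0) (max (absv a * 0) (0 * absv b))) ?F"
      by (intro tendsto_max tendsto_mult a b tendsto_const)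
    then show "(?g \<longlongrightarrow> 0) ?F" by simp
    show "absv (fst z * snd z - a * b) \<le> ?g z" for z
    proof -
      have "fst z * snd z - a * b =
          (fst z - a) * (snd z - b) + (a * (snd z - b) + (fst z - a) * b)"
        by (simp add: algebra_simps)
      then have "absv (fst z * snd z - a * b) \<le>
          max (absv ((fst z - a) * (snd z - b)))
            (max (absv (a * (snd z - b))) (absv ((fst z - a) * b)))"
        by (simp only:) (rule order_trans[OF absv_add_le_max]; intro max.mono order_refl absv_add_le_max)
      then show ?thesis by (simp only: absv_mult)
    qed
  qed
qed

lemma tendsto_power_valued:
  fixes f :: "'b \<Rightarrow> 'w::valued_field"
  shows "(f \<longlongrightarrow> l) F \<Longrightarrow> ((\<lambda>n. f n ^ k) \<longlongrightarrow> l ^ k) F"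
  by (induction k) (auto intro: tendsto_mult)

lemma sums_mult_valued:
  fixes f :: "nat \<Rightarrow> 'w::valued_field"
  shows "f sums s \<Longrightarrow> (\<lambda>n. c * f n) sums (c * s)"
  unfolding sums_def by (simp flip: sum_distrib_left add: tendsto_mult)

lemma sums_minus_valued:
  fixes f :: "nat \<Rightarrow> 'w::valued_field"
  shows "f sums s \<Longrightarrow> (\<lambda>n. - f n) sums (- s)"
  using sums_mult_valued[of f s "-1"] by simp

lemma sums_diff_valued:
  fixes f :: "nat \<Rightarrow> 'w::valued_field"
  shows "f sums s \<Longrightarrow> g sums t \<Longrightarrow> (\<lambda>n. f n - g n) sums (s - t)"
  unfolding sums_def by (simp add: sum_subtractf tendsto_diff)

lemma sums_Suc_iff_valued:
  fixes f :: "nat \<Rightarrow> 'w::valued_field"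
  shows "(\<lambda>n. f (Suc n)) sums s \<longleftrightarrow> f sums (f 0 + s)"
proof
  assume "f sums (f 0 + s)"
  then have "(\<lambda>n. (\<Sum>i<Suc n. f i) - f 0) \<longlonglongrightarrow> f 0 + s - f 0"
    by (intro tendsto_diff tendsto_const LIMSEQ_Suc) (simp add: sums_def)
  then show "(\<lambda>n. f (Suc n)) sums s"
    by (simp add: sums_def sum.lessThan_Suc_shift del: sum.lessThan_Suc)
next
  assume "(\<lambda>n. f (Suc n)) sums s"
  then show "f sums (f 0 + s)"
    using sums_Suc[of f s] by (simp add: add.commute)
qed

lemma sums_absv_le:
  fixes f :: "nat \<Rightarrow> 'w::valued_field"
  assumes "f sums s" and "\<And>n. absv (f n) \<le> B"
  shows "absv s \<le> B"
proof -
  have "0 \<le> B" using assms(2)[of 0] absv_nonneg order_trans by blast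
  then show ?thesis
    using assms by (intro tendsto_absv_le[OF assms(1)[unfolded sums_def]] absv_sum_le)
qed

lemma summable_null_valued:
  fixes f :: "nat \<Rightarrow> 'w::complete_valued_field"
  assumes "(\<lambda>n. absv (f n)) \<longlonglongrightarrow> 0"
  shows "summable f"
proof -
  have "Cauchy (\<lambda>n. \<Sum>i<n. f i)"
  proof (rule metric_CauchyI)
    fix e :: real assume "0 < e"
    then obtain N where N: "\<And>n. n \<ge> N \<Longrightarrow> absv (f n) < e / 2"
      using order_tendstoD(2)[OF assms, of "e / 2"] by (auto simp: eventually_sequentially)
    have le: "absv (sum f {..<n} - sum f {..<m}) < e" if "N \<le> m" "m \<le> n" for m n
    proof -
      have "sum f {..<n} - sum f {..<m} = sum f {m..<n}"
        using that by (simp add: sum_diff_nat_ivl lessThan_atLeast0)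
      moreover have "absv (sum f {m..<n}) \<le> e / 2"
        using that N \<open>0 < e\<close> by (intro absv_sum_le) (auto intro: less_imp_le)
      ultimately show ?thesis using \<open>0 < e\<close> by simp
    qed
    have "dist (sum f {..<m}) (sum f {..<n}) < e" if "N \<le> m" "N \<le> n" for m n
      using le[of m n] le[of n m] that absv_minus_commute[of "sum f {..<m}"]
      by (cases "m \<le> n") (auto simp: dist_absv)
    then show "\<exists>N. \<forall>m\<ge>N. \<forall>n\<ge>N. dist (sum f {..<m}) (sum f {..<n}) < e" by blast
  qed
  then show ?thesis
    by (simp add: summable_iff_convergent Cauchy_convergent)
qed

lemma closure_iff_absv:
  fixes S :: "'w::valued_field set"
  shows "z \<in> closure S \<longleftrightarrow> (\<forall>e>0. \<exists>y\<in>S. absv (z - y) < e)"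
  by (simp add: closure_approachable dist_absv absv_minus_commute)

subsection \<open>The embedded polynomial ring\<close>

lemma finite_degree_less: "finite {p :: 'a::{zero,finite} poly. degree p < n}"
proof (induction n)
  case (Suc n)
  have "{p :: 'a poly. degree p < Suc n} \<subseteq>
      (\<lambda>(a, p). pCons a p) ` (UNIV \<times> insert 0 {p. degree p < n})"
  proof
    fix p :: "'a poly" assume "p \<in> {p. degree p < Suc n}"
    then have deg: "degree p < Suc n" by simp
    obtain a r where p: "p = pCons a r" by (cases p)
    have "r = 0 \<or> degree r < n" using deg by (auto simp: p split: if_splits)
    then show "p \<in> (\<lambda>(a, p). pCons a p) ` (UNIV \<times> insert 0 {p. degree p < n})"
      unfolding p by (intro image_eqI[of _ _ "(a, r)"]) auto
  qed
  then show ?case by (rule finite_subset) (use Suc in auto)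
qed simp

lemma prod_degree_less_Suc:
  fixes f :: "'a::{ab_group_add,finite} poly \<Rightarrow> 'b::comm_monoid_mult"
  assumes "0 < i"
  shows "(\<Prod>\<omega> | degree \<omega> < Suc i. f \<omega>) = (\<Prod>\<alpha>\<in>UNIV. \<Prod>\<omega> | degree \<omega> < i. f (monom \<alpha> i + \<omega>))"
proof -
  have deg: "degree (p - monom (coeff p i) i) < i" if "degree p < Suc i" for p :: "'a poly"
  proof (rule degree_lessI)
    show "\<forall>k\<ge>i. coeff (p - monom (coeff p i) i) k = 0"
    proof (intro allI impI)
      fix k assume "i \<le> k"
      then show "coeff (p - monom (coeff p i) i) k = 0"
        using that by (cases "k = i") (auto intro: coeff_eq_0)
    qed
  qed (use assms in auto)
  have deg': "degree (monom \<alpha> i + p) < Suc i" if "degree p < i" for \<alpha> :: 'a and p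
    using that by (intro le_imp_less_Suc degree_add_le) (auto intro: degree_monom_le)
  have "(\<Prod>\<alpha>\<in>UNIV. \<Prod>\<omega> | degree \<omega> < i. f (monom \<alpha> i + \<omega>)) =
      (\<Prod>z\<in>UNIV \<times> {\<omega>. degree \<omega> < i}. f (monom (fst z) i + snd z))"
    by (simp add: prod.cartesian_product case_prod_beta)
  also have "\<dots> = (\<Prod>\<omega> | degree \<omega> < Suc i. f \<omega>)"
    by (rule prod.reindex_bij_witness[where
          i = "\<lambda>p. (coeff p i, p - monom (coeff p i) i)" and j = "\<lambda>z. monom (fst z) i + snd z"])
      (auto intro: deg deg' simp: coeff_eq_0)
  finally show ?thesis ..
qed

lemma finite_field_power_card:
  fixes x :: "'a::{field,finite}"
  shows "x ^ CARD('a) = x"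
proof (cases "x = 0")
  case False
  have "x * (\<Prod>y\<in>UNIV-{0}. x * y) = x * x ^ (CARD('a) - 1) * \<Prod>(UNIV-{0})"
    by (simp add: prod.distrib mult_ac)
  also have "x * x ^ (CARD('a) - 1) = x ^ CARD('a)"
    by (metis finite_UNIV_card_ge_0 finite power_Suc Suc_diff_1)
  also have "(\<Prod>y\<in>UNIV-{0}. x * y) = (\<Prod>y\<in>UNIV-{0}. y)"
    by (rule prod.reindex_bij_witness[of _ "\<lambda>y. y / x" "\<lambda>y. x * y"]) (use False in auto)
  finally show ?thesis by simp
qed (simp add: zero_power)

lemma of_nat_card_eq_0: "of_nat CARD('a) = (0 :: 'a::{field,finite})"
proof -
  have "(\<Sum>x\<in>UNIV. x + 1 :: 'a) = (\<Sum>x\<in>UNIV. x)"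
    by (rule sum.reindex_bij_witness[of _ "\<lambda>x. x - 1" "\<lambda>x. x + 1"]) auto
  then show ?thesis by (simp add: sum.distrib)
qed

locale carlitz_setting = is_Omega_pi \<pi> \<iota>
  for \<pi> :: "'a::{field,finite} poly" and \<iota> :: "'a poly fract \<Rightarrow> 'w::complete_valued_field" +
  assumes monic: "lead_coeff \<pi> = 1" and irreducible: "irreducible \<pi>"
begin

abbreviation "\<delta> \<equiv> degree \<pi>"
abbreviation "M \<equiv> real CARD('a) ^ degree \<pi>"
abbreviation "E \<equiv> emb_poly \<iota>"
abbreviation "X \<equiv> var_x \<iota>"
abbreviation "cst \<alpha> \<equiv> emb_poly \<iota> [:\<alpha>:]"
abbreviation "br \<equiv> bracket \<iota>"
abbreviation "K \<equiv> K_pi \<iota>"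
abbreviation "\<O> \<equiv> O_pi \<iota>"

lemma q_ge_2: "2 \<le> CARD('a)"
proof -
  have "card {0, 1 :: 'a} \<le> CARD('a)" by (intro card_mono) auto
  then show ?thesis by simp
qed

lemma q_pos [simp]: "0 < CARD('a)" and q_gt_1: "1 < CARD('a)"
  using q_ge_2 by auto

lemma degree_pi_pos: "0 < \<delta>"
proof -
  have "\<pi> \<noteq> 0" and "\<not> is_unit \<pi>" using irreducible by (auto simp: irreducible_def)
  then show ?thesis by (simp add: is_unit_iff_degree)
qed

lemma pi_nonzero: "\<pi> \<noteq> 0"
  using degree_pi_pos by auto

lemma prime_pi: "prime_elem \<pi>"
  using irreducible by (rule field_poly_irreducible_imp_prime)

lemma M_gt_1: "1 < M"
  using q_gt_1 degree_pi_pos by (intro one_less_power) auto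

lemma M_ge_1: "1 \<le> M" and M_pos: "0 < M"
  using M_gt_1 by auto

lemma iota_0: "\<iota> 0 = 0"
  using emb_add[of 0 0] by (metis add_0 add_cancel_right_right)

lemma iota_minus: "\<iota> (- r) = - \<iota> r"
  using emb_add[of r "- r"] iota_0 by (simp add: eq_neg_iff_add_eq_0 add.commute)

lemma E_0 [simp]: "E 0 = 0"
  by (simp add: emb_poly_def iota_0 flip: Zero_fract_def)

lemma E_1 [simp]: "E 1 = 1"
  by (simp add: emb_poly_def emb_one flip: One_fract_def)

lemma E_add: "E (a + b) = E a + E b"
  by (simp add: emb_poly_def flip: emb_add)

lemma E_mult: "E (a * b) = E a * E b"
  by (simp add: emb_poly_def flip: emb_mult)

lemma E_minus: "E (- a) = - E a"
  by (simp add: emb_poly_def flip: iota_minus)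

lemma E_diff: "E (a - b) = E a - E b"
  using E_add[of "a - b" b] by (simp add: algebra_simps)

lemma E_power: "E (a ^ n) = E a ^ n"
  by (induction n) (simp_all add: E_mult)

lemma E_sum: "E (sum f A) = (\<Sum>i\<in>A. E (f i))"
  by (induction A rule: infinite_finite_induct) (simp_all add: E_add)

lemma absv_E: "absv (E p) = poly_pi_abs \<pi> p"
proof -
  have "pi_val \<pi> (1 :: 'a poly) = 0"
    using pi_val_eqI[OF pi_nonzero, of 1 0] irreducible by (simp add: irreducible_def)
  then show ?thesis
    using irreducible by (simp add: emb_poly_def emb_absv pi_abs_Fract) (simp add: poly_pi_abs_def)
qed

lemma E_eq_0_iff [simp]: "E p = 0 \<longleftrightarrow> p = 0"
  using absv_E[of p] poly_pi_abs_eq_0_iff[of \<pi> p] by (metis absv_eq_0_iff)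

lemma E_eq_iff [simp]: "E p = E r \<longleftrightarrow> p = r"
  using E_eq_0_iff[of "p - r"] by (simp add: E_diff)

lemma absv_E_le_1: "absv (E p) \<le> 1"
  using M_gt_1 by (auto simp: absv_E poly_pi_abs_def intro!: power_le_one)

lemma absv_E_not_dvd: "\<not> \<pi> dvd p \<Longrightarrow> absv (E p) = 1"
  using pi_val_eqI[OF pi_nonzero, of p 0] by (auto simp: absv_E poly_pi_abs_def)

lemma absv_E_pi: "absv (E \<pi>) = 1 / M"
  using pi_val_eqI[OF pi_nonzero, of 1 1] irreducible pi_nonzero
  by (auto simp: absv_E poly_pi_abs_def irreducible_def)

lemma absv_E_dvd: "\<pi> dvd p \<Longrightarrow> absv (E p) \<le> 1 / M"
  using absv_E_le_1 M_pos by (auto elim!: dvdE simp: E_mult absv_mult absv_E_pi divide_right_mono)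

lemma E_pCons: "E (pCons a p) = cst a + X * E p"
proof -
  have "pCons a p = [:a:] + [:0, 1:] * p" by simp
  then show ?thesis by (simp only: var_x_def E_add E_mult)
qed

lemma E_monom: "E (monom a n) = cst a * X ^ n"
proof (induction n)
  case (Suc n)
  have "E (monom a (Suc n)) = cst 0 + X * E (monom a n)"
    unfolding monom_Suc by (rule E_pCons)
  then show ?case using Suc by simp
qed (simp add: monom_0)

lemma absv_X_le: "absv X \<le> 1"
  unfolding var_x_def by (rule absv_E_le_1)

lemma cst_0 [simp]: "cst 0 = 0" and cst_1 [simp]: "cst 1 = 1"
  using E_1 by (simp_all flip: one_pCons)

lemma cst_add: "cst (a + b) = cst a + cst b"
  by (simp flip: E_add)

lemma cst_power_q: "cst a ^ CARD('a) = cst a"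
proof -
  have "[:a:] ^ n = [:a ^ n:]" for n by (induction n) (simp_all add: one_pCons)
  then show ?thesis by (simp add: finite_field_power_card flip: E_power)
qed

lemma absv_cst: "a \<noteq> 0 \<Longrightarrow> absv (cst a) = 1"
proof (rule absv_E_not_dvd)
  assume "a \<noteq> 0"
  then show "\<not> \<pi> dvd [:a:]"
    using dvd_imp_degree_le[of \<pi> "[:a:]"] degree_pi_pos by auto
qed

lemma card_range_cst: "card (range cst) = CARD('a)"
  by (intro card_image) (auto simp: inj_def)

lemma prod_diff_cst: "(\<Prod>\<alpha>\<in>UNIV. z - cst \<alpha>) = z ^ CARD('a) - z"
proof -
  let ?p = "\<Prod>\<alpha>\<in>UNIV. [:- cst \<alpha>, 1:]" and ?r = "monom 1 CARD('a) - monom 1 1 :: 'w poly"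
  have deg_p: "degree ?p = CARD('a)"
    by (subst degree_prod_eq_sum_degree) auto
  have lead_p: "lead_coeff ?p = 1"
    by (simp add: lead_coeff_prod)
  have "?p = ?r"
  proof (rule poly_eqI_degree_lead_coeff[where n = "CARD('a)" and A = "range cst"])
    show "coeff ?p CARD('a) = coeff ?r CARD('a)"
      using lead_p deg_p q_gt_1 by simp
    show "degree ?r \<le> CARD('a)"
      using q_gt_1 by (intro degree_diff_le degree_monom_le order_trans[OF degree_monom_le]) auto
    fix z assume "z \<in> range cst"
    then obtain \<alpha> where z: "z = cst \<alpha>" by auto
    have "poly ?p z = (\<Prod>\<beta>\<in>UNIV. cst \<alpha> - cst \<beta>)" by (simp add: poly_prod z)
    also have "\<dots> = 0" by (intro prod_zero) auto
    finally show "poly ?p z = poly ?r z" by (simp add: z poly_monom cst_power_q)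
  qed (simp_all add: deg_p card_range_cst)
  then have "poly ?p z = poly ?r z" by simp
  then show ?thesis by (simp add: poly_prod poly_monom)
qed

lemma power_q_eq_self_iff: "z ^ CARD('a) = z \<longleftrightarrow> z \<in> range cst"
proof
  assume "z ^ CARD('a) = z"
  then have "(\<Prod>\<alpha>\<in>UNIV. z - cst \<alpha>) = 0" by (simp add: prod_diff_cst)
  then obtain \<alpha> where "z - cst \<alpha> = 0" by (subst (asm) prod_zero_iff) auto
  then show "z \<in> range cst" by simp
qed (auto simp: cst_power_q)

text \<open>Both sides are monic polynomials of the same degree as the number of elements of the finite
  field, so it suffices to compare them there: first for \<open>y\<close> in that field, then for arbitrary
  \<open>y\<close>.\<close>

lemma frobenius_add: "(z + y) ^ CARD('a) = z ^ CARD('a) + (y :: 'w) ^ CARD('a)"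
proof -
  have *: "(z + y) ^ CARD('a) = z ^ CARD('a) + y ^ CARD('a)"
    if y: "\<And>\<alpha>. (cst \<alpha> + y) ^ CARD('a) = cst \<alpha> + y ^ CARD('a)" for y z :: 'w
  proof -
    let ?p = "[:y, 1:] ^ CARD('a)" and ?r = "monom 1 CARD('a) + [:y ^ CARD('a):]"
    have deg: "degree ?p = CARD('a)" by (simp add: degree_linear_power)
    have lead_p: "lead_coeff ?p = 1" by (subst lead_coeff_power) simp
    have "?p = ?r"
    proof (rule poly_eqI_degree_lead_coeff[where n = "CARD('a)" and A = "range cst"])
      show "coeff ?p CARD('a) = coeff ?r CARD('a)"
        using lead_p deg coeff_eq_0[of "[:y ^ CARD('a):]" "CARD('a)"] by simp
      show "degree ?r \<le> CARD('a)"
        by (intro degree_add_le degree_monom_le) auto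
      show "poly ?p z = poly ?r z" if "z \<in> range cst" for z
        using that y by (auto simp: poly_monom add.commute cst_power_q)
    qed (simp_all add: deg card_range_cst)
    then have "poly ?p z = poly ?r z" by simp
    then show ?thesis by (simp add: poly_monom add.commute)
  qed
  have "(z + cst \<beta>) ^ CARD('a) = z ^ CARD('a) + cst \<beta> ^ CARD('a)" for z \<beta>
    by (rule *) (simp add: cst_power_q flip: cst_add)
  from this[of y] show ?thesis by (intro *) (simp add: add.commute cst_power_q)
qed

lemma frobenius_diff: "(z - y) ^ CARD('a) = z ^ CARD('a) - (y :: 'w) ^ CARD('a)"
  using frobenius_add[of "z - y" y] by simp

lemma frobenius_sum: "finite A \<Longrightarrow> (sum f A :: 'w) ^ CARD('a) = (\<Sum>i\<in>A. f i ^ CARD('a))"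
  by (induction A rule: finite_induct) (simp_all add: frobenius_add zero_power)

lemma frobenius_iter_diff: "(z - y) ^ CARD('a) ^ n = z ^ CARD('a) ^ n - (y :: 'w) ^ CARD('a) ^ n"
proof (induction n)
  case (Suc n)
  then show ?case
    by (simp only: power_Suc2 power_mult frobenius_diff)
qed simp

lemma frobenius_iter_add: "(z + y) ^ CARD('a) ^ n = z ^ CARD('a) ^ n + (y :: 'w) ^ CARD('a) ^ n"
  using frobenius_iter_diff[of "z + y" y n] by simp

lemma cst_power_q_iter: "cst a ^ CARD('a) ^ n = cst a"
  by (induction n) (simp_all only: power_Suc power_mult cst_power_q power_0 power_one_right)

lemma frobenius_inj: "z ^ CARD('a) = (y :: 'w) ^ CARD('a) \<Longrightarrow> z = y"
  using frobenius_diff[of z y] by simp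

subsection \<open>The completion and its integers\<close>

lemma K_iff: "t \<in> K \<longleftrightarrow> (\<forall>e>0. \<exists>r. absv (t - \<iota> r) < e)"
  by (auto simp: K_pi_def closure_iff_absv)

lemma iota_in_K: "\<iota> r \<in> K"
  unfolding K_pi_def by (rule subsetD[OF closure_subset]) simp

lemma E_in_K: "E p \<in> K"
  unfolding emb_poly_def by (rule iota_in_K)

lemma K_add: "s \<in> K \<Longrightarrow> t \<in> K \<Longrightarrow> s + t \<in> K"
proof (unfold K_iff, intro allI impI)
  fix e :: real
  assume s: "\<forall>e>0. \<exists>r. absv (s - \<iota> r) < e" and t: "\<forall>e>0. \<exists>r. absv (t - \<iota> r) < e" and "0 < e"
  then obtain r r' where "absv (s - \<iota> r) < e" "absv (t - \<iota> r') < e" by blast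
  then have "absv (s + t - \<iota> (r + r')) < e"
    using absv_add_le_max[of "s - \<iota> r" "t - \<iota> r'"] by (simp add: emb_add algebra_simps)
  then show "\<exists>r. absv (s + t - \<iota> r) < e" ..
qed

lemma K_mult: "s \<in> K \<Longrightarrow> t \<in> K \<Longrightarrow> s * t \<in> K"
proof -
  assume "s \<in> K" "t \<in> K"
  then obtain f g where f: "\<And>n. f n \<in> range \<iota>" "f \<longlonglongrightarrow> s" and g: "\<And>n. g n \<in> range \<iota>" "g \<longlonglongrightarrow> t"
    unfolding K_pi_def closure_sequential by blast
  have "f n * g n \<in> range \<iota>" for n
    using f(1)[of n] g(1)[of n] by (auto simp flip: emb_mult)
  moreover have "(\<lambda>n. f n * g n) \<longlonglongrightarrow> s * t" by (intro tendsto_mult f g)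
  ultimately show ?thesis
    unfolding K_pi_def closure_sequential by (intro exI[of _ "\<lambda>n. f n * g n"]) auto
qed

lemma K_E_mult: "t \<in> K \<Longrightarrow> E p * t \<in> K"
  by (intro K_mult E_in_K)

lemma K_diff: "s \<in> K \<Longrightarrow> t \<in> K \<Longrightarrow> s - t \<in> K"
  using K_add[OF _ K_E_mult[of t "- 1"], of s] by (simp add: E_minus)

lemma O_add: "s \<in> \<O> \<Longrightarrow> t \<in> \<O> \<Longrightarrow> s + t \<in> \<O>"
  by (auto simp: O_pi_def K_add absv_add_le)

lemma O_diff: "s \<in> \<O> \<Longrightarrow> t \<in> \<O> \<Longrightarrow> s - t \<in> \<O>"
  by (auto simp: O_pi_def K_diff absv_diff_le)

lemma O_mult: "s \<in> \<O> \<Longrightarrow> t \<in> \<O> \<Longrightarrow> s * t \<in> \<O>"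
  by (auto simp: O_pi_def K_mult absv_mult mult_le_one)

lemma E_in_O: "E p \<in> \<O>"
  by (simp add: O_pi_def E_in_K absv_E_le_1)

lemma X_in_O: "X \<in> \<O>" and X_power_in_O: "X ^ k \<in> \<O>"
  using E_in_O[of "[:0, 1:]"] E_in_O[of "[:0, 1:] ^ k"] by (simp_all add: var_x_def E_power)

lemma zero_in_O: "0 \<in> \<O>"
  using E_in_O[of 0] by simp

lemma absv_le_1_O: "t \<in> \<O> \<Longrightarrow> absv t \<le> 1"
  by (simp add: O_pi_def)

lemma O_sum: "(\<And>i. i \<in> A \<Longrightarrow> f i \<in> \<O>) \<Longrightarrow> sum f A \<in> \<O>"
  by (induction A rule: infinite_finite_induct) (auto intro: O_add zero_in_O)

lemma degree_mod_pi: "degree (p mod \<pi>) < \<delta>"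
  using degree_mod_less[OF pi_nonzero, of p] degree_pi_pos by auto

text \<open>Multiplication by \<open>b\<close> is injective on the finite set of residues, hence onto.\<close>

lemma inverse_mod_pi:
  assumes "\<not> \<pi> dvd b"
  obtains c where "\<pi> dvd 1 - b * c"
proof -
  let ?R = "{p :: 'a poly. degree p < \<delta>}"
  have "inj_on (\<lambda>p. b * p mod \<pi>) ?R"
  proof (rule inj_onI)
    fix p r assume "p \<in> ?R" "r \<in> ?R" and "b * p mod \<pi> = b * r mod \<pi>"
    then have deg: "degree p < \<delta>" "degree r < \<delta>" and "\<pi> dvd b * (p - r)"
      by (auto simp: mod_eq_dvd_iff right_diff_distrib)
    then have "\<pi> dvd p - r"
      using assms prime_pi by (simp add: prime_elem_dvd_mult_iff)
    moreover have "degree (p - r) < \<delta>"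
      using deg by (rule degree_diff_less)
    ultimately show "p = r"
      using dvd_imp_degree_le[of \<pi> "p - r"] by auto
  qed
  moreover have "(\<lambda>p. b * p mod \<pi>) ` ?R \<subseteq> ?R"
    using degree_mod_pi by auto
  ultimately have "(\<lambda>p. b * p mod \<pi>) ` ?R = ?R"
    by (intro endo_inj_surj finite_degree_less)
  moreover have "1 \<in> ?R" using degree_pi_pos by simp
  ultimately obtain c where "1 = b * c mod \<pi>" by blast
  then have "1 mod \<pi> = b * c mod \<pi>" by (metis mod_mod_trivial)
  then have "\<pi> dvd 1 - b * c" by (simp only: mod_eq_dvd_iff)
  then show thesis by (rule that)
qed

lemma dense_unit_inverse:
  assumes "\<not> \<pi> dvd b" and "0 < e"
  obtains p where "absv (inverse (E b) - E p) < e"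
proof -
  obtain c where c: "\<pi> dvd 1 - b * c" using inverse_mod_pi[OF assms(1)] .
  define y where "y = E (1 - b * c)"
  have y: "absv y \<le> 1 / M" unfolding y_def by (rule absv_E_dvd[OF c])
  have "1 / M < 1" using M_gt_1 by simp
  then obtain n where n: "(1 / M) ^ n < e"
    using real_arch_pow_inv[OF \<open>0 < e\<close>] by blast
  have b: "E b \<noteq> 0" "absv (E b) = 1" using assms(1) by (auto simp: absv_E_not_dvd)
  define p where "p = c * (\<Sum>i<n. (1 - b * c) ^ i)"
  have "E b * E p = (1 - y) * (\<Sum>i<n. y ^ i)"
    by (simp add: p_def y_def E_mult E_sum E_power E_diff mult.assoc)
  also have "\<dots> = 1 - y ^ n" by (simp add: one_diff_power_eq)
  finally have "inverse (E b) - E p = y ^ n / E b"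
    using b(1) by (simp add: field_simps)
  then have "absv (inverse (E b) - E p) = absv y ^ n"
    by (simp add: absv_divide absv_power b)
  also have "\<dots> \<le> (1 / M) ^ n" by (intro power_mono y) simp
  finally have "absv (inverse (E b) - E p) < e" using n by simp
  then show thesis by (rule that)
qed

lemma dense_O:
  assumes "t \<in> \<O>" and "0 < e"
  obtains p where "absv (t - E p) < e"
proof -
  from assms(1) have "t \<in> K" and t1: "absv t \<le> 1" by (auto simp: O_pi_def)
  then obtain r where r: "absv (t - \<iota> r) < min e 1"
    using \<open>0 < e\<close> unfolding K_iff by (metis min_less_iff_conj zero_less_one)
  have r1: "absv (\<iota> r) \<le> 1"
    using absv_diff_le_max[of t "t - \<iota> r"] r t1 by (auto simp: max_def split: if_splits)
  obtain a b where ab: "r = Fract a b" "b \<noteq> 0" by (cases r) auto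
  have "\<exists>p. absv (\<iota> r - E p) < e"
  proof (cases "a = 0")
    case True
    then have "\<iota> r = 0" using ab by (simp add: iota_0 rat_number_collapse fract_collapse)
    then show ?thesis using \<open>0 < e\<close> by (intro exI[of _ 0]) simp
  next
    case False
    obtain a' where a': "a = \<pi> ^ pi_val \<pi> a * a'" "\<not> \<pi> dvd a'"
      using pi_val_decompose[OF irreducible False] .
    obtain b' where b': "b = \<pi> ^ pi_val \<pi> b * b'" "\<not> \<pi> dvd b'"
      using pi_val_decompose[OF irreducible ab(2)] .
    have E\<pi>: "E \<pi> \<noteq> 0" and Eb': "E b' \<noteq> 0" using pi_nonzero b'(2) by auto
    have "r * Fract b 1 = Fract a 1" using ab by (simp add: eq_fract)
    then have rb: "\<iota> r * E b = E a" unfolding emb_poly_def by (simp flip: emb_mult)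
    have aa: "absv (E a) = (1 / M) ^ pi_val \<pi> a" and bb: "absv (E b) = (1 / M) ^ pi_val \<pi> b"
      using False ab(2) by (auto simp: absv_E poly_pi_abs_def)
    have "(1 / M) ^ pi_val \<pi> a \<le> (1 / M) ^ pi_val \<pi> b"
      using arg_cong[OF rb, of absv] r1 mult_right_mono[OF r1, of "absv (E b)"]
      by (simp add: absv_mult aa bb)
    then have le: "pi_val \<pi> b \<le> pi_val \<pi> a"
      using M_gt_1 by (subst (asm) power_decreasing_iff) auto
    define k where "k = pi_val \<pi> a - pi_val \<pi> b"
    have \<pi>_split: "\<pi> ^ pi_val \<pi> a = \<pi> ^ pi_val \<pi> b * \<pi> ^ k"
      using le by (simp add: k_def flip: power_add)
    have "a = \<pi> ^ pi_val \<pi> b * (\<pi> ^ k * a')"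
      using a'(1) \<pi>_split by (metis mult.assoc)
    then have "\<iota> r * (E \<pi> ^ pi_val \<pi> b * E b') = E \<pi> ^ pi_val \<pi> b * E (\<pi> ^ k * a')"
      using rb b'(1) by (metis E_mult E_power)
    then have r_eq: "\<iota> r = E (\<pi> ^ k * a') * inverse (E b')"
      using E\<pi> Eb' by (simp add: field_simps)
    obtain p where p: "absv (inverse (E b') - E p) < e"
      using dense_unit_inverse[OF b'(2) \<open>0 < e\<close>] .
    have "\<iota> r - E (\<pi> ^ k * a' * p) = E (\<pi> ^ k * a') * (inverse (E b') - E p)"
      by (simp only: r_eq E_mult right_diff_distrib)
    then have "absv (\<iota> r - E (\<pi> ^ k * a' * p)) < e"
      using p absv_E_le_1[of "\<pi> ^ k * a'"]
        mult_right_mono[of "absv (E (\<pi> ^ k * a'))" 1 "absv (inverse (E b') - E p)"]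
      by (simp add: absv_mult)
    then show ?thesis ..
  qed
  then obtain p where p: "absv (\<iota> r - E p) < e" ..
  have "absv (t - E p) < e"
    using absv_add_le_max[of "t - \<iota> r" "\<iota> r - E p"] p r by (auto simp: max_def split: if_splits)
  then show thesis by (rule that)
qed

lemma O_residue:
  assumes "t \<in> \<O>"
  obtains r where "degree r < \<delta>" and "absv (t - E r) \<le> 1 / M"
proof -
  obtain p where p: "absv (t - E p) < 1 / M"
    using dense_O[OF assms, of "1 / M"] M_pos by auto
  have "absv (E (p - p mod \<pi>)) \<le> 1 / M" by (intro absv_E_dvd) (simp add: minus_mod_eq_mult_div)
  then have "absv (t - E p + E (p - p mod \<pi>)) \<le> 1 / M" using p by (intro absv_add_le) auto
  then have "absv (t - E (p mod \<pi>)) \<le> 1 / M" by (simp add: E_diff)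
  with degree_mod_pi show thesis by (rule that)
qed

subsection \<open>Roots in the completed algebraic closure\<close>

lemma algebraic_iota: "\<iota> r \<in> algebraic_elements K"
  unfolding algebraic_elements_def
proof (intro CollectI exI conjI allI)
  show "[:- \<iota> r, 1:] \<noteq> 0" by simp
  show "coeff [:- \<iota> r, 1:] n \<in> K" for n
    using iota_in_K[of "- r"] iota_in_K[of 1] iota_in_K[of 0]
    by (auto simp: coeff_pCons iota_minus emb_one iota_0 split: nat.splits)
qed simp

lemma algebraic_0: "0 \<in> algebraic_elements K" and algebraic_1: "1 \<in> algebraic_elements K"
  and algebraic_m1: "- 1 \<in> algebraic_elements K"
  using algebraic_iota[of 0] algebraic_iota[of 1] algebraic_iota[of "- 1"]
  by (simp_all add: iota_0 emb_one iota_minus)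

lemma algebraic_approx:
  assumes "0 < e"
  obtains a where "a \<in> algebraic_elements K" and "absv (z - a) < e"
proof -
  have "z \<in> closure (algebraic_elements K)" by (simp add: dense)
  then show thesis using that assms by (auto simp: closure_iff_absv)
qed

lemma algebraic_trinomial_root:
  assumes "a \<in> algebraic_elements K" and "c \<in> {0, - 1}"
  obtains z where "z ^ CARD('a) + c * z + a = 0"
proof -
  let ?p = "monom 1 CARD('a) + [:a, c:]"
  have "coeff ?p n \<in> algebraic_elements K" for n
  proof -
    consider "n = 0" | "n = 1" | "n = CARD('a)" | "1 < n" "n \<noteq> CARD('a)" by linarith
    then show ?thesis
      using algebraic_0 algebraic_1 algebraic_m1 assms q_gt_1
      by cases (auto simp: coeff_pCons split: nat.splits)
  qed
  moreover have "degree ?p = CARD('a)"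
    using q_gt_1 by (subst degree_add_eq_left) (auto simp: degree_monom_eq)
  ultimately obtain z where "poly ?p z = 0"
    using alg_closed[of ?p] q_pos by auto
  then show thesis by (intro that[of z]) (simp add: poly_monom algebra_simps)
qed

lemma root_q_exists: obtains y where "y ^ CARD('a) = (z :: 'w)"
proof -
  have "\<exists>y. absv (y ^ CARD('a) - z) < (1 / 2) ^ n" for n
  proof -
    obtain a where a: "a \<in> algebraic_elements K" "absv (- z - a) < (1 / 2) ^ n"
      using algebraic_approx[of "(1 / 2) ^ n" "- z"] by auto
    obtain y where "y ^ CARD('a) + 0 * y + a = 0"
      using algebraic_trinomial_root[OF a(1), of 0] by auto
    then have "y ^ CARD('a) - z = - z - a" by (simp add: algebra_simps eq_neg_iff_add_eq_0)
    then show ?thesis using a(2) by metis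
  qed
  then obtain f where f: "\<And>n. absv (f n ^ CARD('a) - z) < (1 / 2) ^ n" by metis
  have lim: "(\<lambda>n. f n ^ CARD('a)) \<longlonglongrightarrow> z"
    using f
    by (intro tendsto_absv_diffI[OF LIMSEQ_power_zero[of "1 / 2 :: real"]]) (auto intro: less_imp_le)
  have "Cauchy f"
  proof (rule metric_CauchyI)
    fix e :: real assume "0 < e"
    then have "0 < e ^ CARD('a)" by simp
    then obtain N where N: "\<And>m n. m \<ge> N \<Longrightarrow> n \<ge> N \<Longrightarrow>
        absv (f m ^ CARD('a) - f n ^ CARD('a)) < e ^ CARD('a)"
      using metric_CauchyD[OF LIMSEQ_imp_Cauchy[OF lim]] unfolding dist_absv by blast
    have "dist (f m) (f n) < e" if "m \<ge> N" "n \<ge> N" for m n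
    proof (rule power_less_imp_less_base)
      show "dist (f m) (f n) ^ CARD('a) < e ^ CARD('a)"
        using N[OF that] by (simp add: dist_absv absv_power flip: frobenius_diff)
    qed (use \<open>0 < e\<close> in simp)
    then show "\<exists>N. \<forall>m\<ge>N. \<forall>n\<ge>N. dist (f m) (f n) < e" by blast
  qed
  then obtain y where "f \<longlonglongrightarrow> y"
    using Cauchy_convergent[of f] unfolding convergent_def by blast
  then have "(\<lambda>n. f n ^ CARD('a)) \<longlonglongrightarrow> y ^ CARD('a)" by (rule tendsto_power_valued)
  then have "y ^ CARD('a) = z" using lim by (rule LIMSEQ_unique)
  then show thesis by (rule that)
qed

subsection \<open>Artin-Schreier equations\<close>

lemma absv_power_q_tendsto:
  assumes "absv (b :: 'w) < 1"
  shows "(\<lambda>j. absv (b ^ CARD('a) ^ j)) \<longlonglongrightarrow> 0"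
  unfolding absv_power
proof (rule filterlim_compose[OF LIMSEQ_power_zero])
  show "LIM j sequentially. CARD('a) ^ j :> sequentially"
    using q_gt_1 by (intro filterlim_subseq) (auto simp: strict_mono_def)
qed (use assms in simp)

lemma summable_power_q:
  assumes "absv (b :: 'w) < 1"
  shows "summable (\<lambda>j. b ^ CARD('a) ^ j)"
  using absv_power_q_tendsto[OF assms] by (rule summable_null_valued)

lemma power_q_suminf:
  assumes "absv (b :: 'w) < 1"
  shows "suminf (\<lambda>j. b ^ CARD('a) ^ j) - suminf (\<lambda>j. b ^ CARD('a) ^ j) ^ CARD('a) = b"
proof -
  let ?f = "\<lambda>j. b ^ CARD('a) ^ j" and ?s = "\<Sum>j. b ^ CARD('a) ^ j"
  have lim: "(\<lambda>n. sum ?f {..<n}) \<longlonglongrightarrow> ?s"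
    using summable_LIMSEQ[OF summable_power_q[OF assms]] .
  have step: "sum ?f {..<n} ^ CARD('a) = sum ?f {..<Suc n} - b" for n
    unfolding sum.lessThan_Suc_shift
    by (simp add: frobenius_sum mult.commute[of "CARD('a)"] flip: power_mult)
  have "(\<lambda>n. sum ?f {..<n} ^ CARD('a)) \<longlonglongrightarrow> ?s - b"
    unfolding step by (intro tendsto_diff tendsto_const LIMSEQ_Suc lim)
  with tendsto_power_valued[OF lim] have "?s ^ CARD('a) = ?s - b" by (rule LIMSEQ_unique)
  then show ?thesis by simp
qed

lemma absv_power_q_le:
  assumes "absv (b :: 'w) \<le> 1"
  shows "absv (b ^ CARD('a) ^ j) \<le> absv b"
  using power_decreasing[of 1 "CARD('a) ^ j" "absv b"] assms by (simp add: absv_power)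

lemma suminf_power_q_absv_le:
  assumes "absv (b :: 'w) < 1"
  shows "absv (suminf (\<lambda>j. b ^ CARD('a) ^ j)) \<le> absv b"
  using assms
  by (intro sums_absv_le[OF summable_sums[OF summable_power_q]] absv_power_q_le) auto

lemma sums_power_q_unique:
  assumes "absv (b :: 'w) < 1" and "absv z < 1" and "z - z ^ CARD('a) = b"
  shows "(\<lambda>j. b ^ CARD('a) ^ j) sums z"
proof -
  let ?s = "\<Sum>j. b ^ CARD('a) ^ j"
  have s: "?s ^ CARD('a) = ?s - b" and z: "z ^ CARD('a) = z - b"
    using power_q_suminf[OF assms(1)] assms(3) by (simp_all add: algebra_simps)
  have "(z - ?s) ^ CARD('a) = z - ?s"
    by (simp add: frobenius_diff s z)
  then obtain \<alpha> where \<alpha>: "z - ?s = cst \<alpha>"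
    unfolding power_q_eq_self_iff by auto
  moreover have "absv (z - ?s) < 1"
    using suminf_power_q_absv_le[OF assms(1)] absv_diff_le_max[of z ?s] assms by simp
  ultimately have "\<alpha> = 0" using absv_cst[of \<alpha>] by auto
  then show ?thesis using \<alpha> summable_sums[OF summable_power_q[OF assms(1)]] by simp
qed

lemma artin_schreier_root: obtains z where "z ^ CARD('a) - z + b = (0 :: 'w)"
proof -
  obtain a where a: "a \<in> algebraic_elements K" "absv (b - a) < 1"
    using algebraic_approx[of 1 b] by auto
  obtain z where z: "z ^ CARD('a) + (- 1) * z + a = 0"
    using algebraic_trinomial_root[OF a(1), of "- 1"] by auto
  define y where "y = suminf (\<lambda>j. (b - a) ^ CARD('a) ^ j)"
  have "y - y ^ CARD('a) = b - a" unfolding y_def by (rule power_q_suminf[OF a(2)])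
  then have y: "y ^ CARD('a) = y - (b - a)" by (simp add: algebra_simps)
  have z': "z ^ CARD('a) = z - a" using z by (simp add: algebra_simps)
  have "(z + y) ^ CARD('a) - (z + y) + b = 0" by (simp add: frobenius_add y z')
  then show thesis by (rule that)
qed

lemma card_artin_schreier: "card {z. z ^ CARD('a) - z + b = (0 :: 'w)} = CARD('a)"
proof -
  obtain z where z: "z ^ CARD('a) - z + b = 0" using artin_schreier_root .
  have "{y. y ^ CARD('a) - y + b = 0} = (+) z ` range cst"
  proof (intro equalityI subsetI)
    fix y assume "y \<in> {y. y ^ CARD('a) - y + b = 0}"
    then have y': "y ^ CARD('a) = y - b" by (simp add: algebra_simps)
    have z': "z ^ CARD('a) = z - b" using z by (simp add: algebra_simps)
    have "(y - z) ^ CARD('a) = y - z" by (simp add: frobenius_diff y' z')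
    then have "y - z \<in> range cst" by (simp only: power_q_eq_self_iff)
    then show "y \<in> (+) z ` range cst" by (intro image_eqI[of _ _ "y - z"]) auto
  next
    fix y assume "y \<in> (+) z ` range cst"
    then obtain \<alpha> where "y = z + cst \<alpha>" by auto
    then show "y \<in> {y. y ^ CARD('a) - y + b = 0}"
      using z by (simp add: frobenius_add cst_power_q)
  qed
  then show ?thesis by (simp add: card_image card_range_cst)
qed

lemma artin_schreier_absv_le:
  assumes "z ^ CARD('a) - z + b = 0" and "absv b \<le> 1"
  shows "absv z \<le> (1 :: real)"
proof (rule ccontr)
  assume "\<not> absv z \<le> 1"
  then have z: "1 < absv z" by simp
  have "z ^ CARD('a) = z - b" using assms(1) by (simp add: algebra_simps)
  then have "absv z ^ CARD('a) \<le> absv z"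
    using absv_diff_le_max[of z b] assms(2) z by (simp flip: absv_power)
  moreover have "absv z ^ 1 < absv z ^ CARD('a)"
    using z q_gt_1 by (intro power_strict_increasing) auto
  ultimately show False by simp
qed

subsection \<open>The brackets\<close>

lemma bracket_eq_E: "br n = E (monom 1 (CARD('a) ^ n) - monom 1 1)"
  by (simp add: bracket_def E_diff E_monom)

lemma absv_bracket_le_1: "absv (br n) \<le> 1"
  unfolding bracket_eq_E by (rule absv_E_le_1)

text \<open>The derivative of the bracket, as a polynomial in x, is -1, so the bracket is squarefree.\<close>

lemma absv_bracket_ge:
  assumes "0 < n"
  shows "1 / M \<le> absv (br n)"
proof (cases "\<pi> dvd monom 1 (CARD('a) ^ n) - monom 1 1")
  case False
  then show ?thesis using M_ge_1 by (simp add: bracket_eq_E absv_E_not_dvd)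
next
  case True
  then obtain r where r: "monom 1 (CARD('a) ^ n) - monom 1 1 = \<pi> * r" by (elim dvdE)
  have "\<not> \<pi> dvd r"
  proof
    assume "\<pi> dvd r"
    then obtain s where s: "r = \<pi> * s" by (elim dvdE)
    have "of_nat (CARD('a) ^ n) = (0 :: 'a)"
      using assms of_nat_card_eq_0 by (simp add: zero_power)
    then have "pderiv (monom 1 (CARD('a) ^ n) - monom 1 1 :: 'a poly) = - 1"
      by (simp only: pderiv_diff pderiv_monom mult_zero_left) (simp add: monom_0 one_pCons)
    moreover have "pderiv (\<pi> * (\<pi> * s)) = \<pi> * (pderiv (\<pi> * s) + pderiv \<pi> * s)"
      by (simp add: pderiv_mult algebra_simps)
    ultimately have "\<pi> dvd - 1" using r s by (metis dvd_triv_left)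
    then show False using irreducible by (simp add: irreducible_def)
  qed
  then show ?thesis
    unfolding bracket_eq_E r by (simp add: E_mult absv_mult absv_E_pi absv_E_not_dvd)
qed

lemma bracket_nonzero: "0 < n \<Longrightarrow> br n \<noteq> 0"
proof
  assume "0 < n" and "br n = 0"
  then have "1 / M \<le> 0" using absv_bracket_ge[of n] by (simp only: absv_0)
  then show False using M_pos by (simp only: divide_le_0_1_iff)
qed

lemma absv_divide_bracket_le:
  assumes "0 < n" and "absv z \<le> B"
  shows "absv (z / br n) \<le> M * B"
proof -
  have "1 \<le> M * absv (br n)" using absv_bracket_ge[OF assms(1)] M_pos by (simp add: field_simps)
  then have "absv z * 1 \<le> B * (M * absv (br n))"
    using assms(2) by (intro mult_mono) (auto intro: order_trans[OF absv_nonneg])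
  then show ?thesis
    using bracket_nonzero[OF assms(1)] by (simp add: absv_divide field_simps)
qed

lemma bracket_power_q: "br n ^ CARD('a) = X ^ CARD('a) ^ Suc n - X ^ CARD('a)"
  by (simp add: bracket_def frobenius_diff mult.commute flip: power_mult)

lemma carlitz_D_Suc: "carlitz_D \<iota> (Suc i) = br (Suc i) * carlitz_D \<iota> i ^ CARD('a)"
proof -
  have "(\<Prod>j = 1..i. br j ^ CARD('a) ^ (Suc i - j)) = (\<Prod>j = 1..i. (br j ^ CARD('a) ^ (i - j)) ^ CARD('a))"
    by (intro prod.cong) (simp_all add: Suc_diff_le mult.commute flip: power_mult)
  then show ?thesis
    by (simp add: carlitz_D_def prod_power_distrib mult.commute)
qed

lemma carlitz_D_nonzero: "carlitz_D \<iota> i \<noteq> 0"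
  by (auto simp: carlitz_D_def bracket_nonzero)

subsection \<open>Carlitz polynomials\<close>

primrec F :: "nat \<Rightarrow> 'w \<Rightarrow> 'w" where
  "F 0 t = t"
| "F (Suc i) t = (F i t ^ CARD('a) - F i t) / br (Suc i)"

declare F.simps(2) [simp del]

lemma F_power_q: "F i t ^ CARD('a) = F i t + br (Suc i) * F (Suc i) t"
  using bracket_nonzero[of "Suc i"] by (simp add: F.simps)

lemma F_add: "F i (s + t) = F i s + F i t"
  by (induction i) (simp_all add: F.simps(2) frobenius_add add_divide_distrib diff_divide_distrib)

lemma F_cst_mult: "F i (cst a * t) = cst a * F i t"
  by (induction i)
    (simp_all add: F.simps(2) power_mult_distrib cst_power_q diff_divide_distrib right_diff_distrib)

lemma F_0_right [simp]: "F i 0 = 0"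
  using F_add[of i 0 0] by (metis add_0 add_cancel_right_right)

lemma F_diff: "F i (s - t) = F i s - F i t"
  using F_add[of i "s - t" t] by simp

lemma F_X_mult: "F (Suc i) (X * t) = X * F (Suc i) t + F i t ^ CARD('a)"
proof (induction i)
  case 0
  have "X ^ CARD('a) = X + br 1" by (simp add: bracket_def)
  then have "(X * t) ^ CARD('a) - X * t = X * (t ^ CARD('a) - t) + br 1 * t ^ CARD('a)"
    by (simp add: power_mult_distrib algebra_simps)
  then show ?case
    using bracket_nonzero[of 1] by (simp add: F.simps(2) add_divide_distrib)
next
  case (Suc i)
  let ?f = "F i t" and ?g = "F (Suc i) t" and ?b = "br (Suc (Suc i))"
  have "(?f ^ CARD('a)) ^ CARD('a) = ?f ^ CARD('a) + br (Suc i) ^ CARD('a) * ?g ^ CARD('a)"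
    using F_power_q[of i t] by (metis frobenius_add power_mult_distrib)
  then have "(X * ?g + ?f ^ CARD('a)) ^ CARD('a) - (X * ?g + ?f ^ CARD('a)) =
      X ^ CARD('a) * ?g ^ CARD('a) + br (Suc i) ^ CARD('a) * ?g ^ CARD('a) - X * ?g"
    by (simp add: frobenius_add power_mult_distrib)
  also have "\<dots> = X * (?g ^ CARD('a) - ?g) + ?b * ?g ^ CARD('a)"
    unfolding bracket_power_q bracket_def[of _ "Suc (Suc i)"] by (simp add: algebra_simps del: power_Suc)
  finally have "F (Suc (Suc i)) (X * t) = (X * (?g ^ CARD('a) - ?g) + ?b * ?g ^ CARD('a)) / ?b"
    by (simp only: F.simps(2)[of "Suc i"] Suc)
  then show ?case
    using bracket_nonzero[of "Suc (Suc i)"]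
    by (simp add: F.simps(2)[of "Suc i" t] add_divide_distrib)
qed

lemma F_1: "F (Suc i) 1 = 0"
proof (induction i)
  case (Suc i)
  then show ?case by (simp only: F.simps(2)[of "Suc i"]) (simp add: zero_power)
qed (simp add: F.simps(2))

lemma F_X_power: "(k < i \<longrightarrow> F i (X ^ k) = 0) \<and> (F k (X ^ k) = 1)"
proof (induction k arbitrary: i)
  case 0
  then show ?case using F_1 by (cases i) auto
next
  case (Suc k)
  have "F (Suc j) (X ^ Suc k) = 0" if "k < j" for j
    using Suc[of "Suc j"] Suc[of j] that by (simp add: F_X_mult zero_power)
  moreover have "F (Suc k) (X ^ Suc k) = 1"
    using Suc[of "Suc k"] by (simp add: F_X_mult)
  ultimately show ?case by (cases i) auto
qed

lemma F_X_power_less: "k < i \<Longrightarrow> F i (X ^ k) = 0" and F_X_power_eq: "F k (X ^ k) = 1"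
  using F_X_power by blast+

lemma absv_F_E_le: "absv (F i (E p)) \<le> 1"
proof (induction p arbitrary: i)
  case (pCons a p)
  have 1: "absv (F i (cst a)) \<le> 1"
    using F_cst_mult[of i a 1] F_1 absv_E_le_1[of "[:a:]"] by (cases i) simp_all
  have "absv (F i (X * E p)) \<le> 1"
  proof (cases i)
    case 0
    then show ?thesis using absv_X_le absv_E_le_1[of p] by (simp add: absv_mult mult_le_one)
  next
    case (Suc j)
    have "absv (X * F (Suc j) (E p)) \<le> 1" "absv (F j (E p) ^ CARD('a)) \<le> 1"
      using absv_X_le pCons(2) by (simp_all add: absv_mult absv_power mult_le_one power_le_one)
    then show ?thesis unfolding Suc F_X_mult by (rule absv_add_le)
  qed
  then show ?case
    by (subst E_pCons, subst F_add) (intro absv_add_le 1)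
qed simp

lemma tendsto_F: "f \<longlonglongrightarrow> t \<Longrightarrow> (\<lambda>n. F i (f n)) \<longlonglongrightarrow> F i t"
  by (induction i)
    (simp_all add: F.simps(2) divide_inverse tendsto_mult tendsto_diff tendsto_power_valued)

lemma absv_F_le_1:
  assumes "t \<in> \<O>"
  shows "absv (F i t) \<le> 1"
proof -
  have "\<exists>p. absv (t - E p) < (1 / 2) ^ n" for n
    using dense_O[OF assms, of "(1 / 2) ^ n"] by auto
  then obtain p where p: "\<And>n. absv (t - E (p n)) < (1 / 2) ^ n" by metis
  have "(\<lambda>n. E (p n)) \<longlonglongrightarrow> t"
    using p by (intro tendsto_absv_diffI[OF LIMSEQ_power_zero[of "1 / 2 :: real"]])
      (auto intro: less_imp_le simp: absv_minus_commute[of _ t])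
  then show ?thesis
    by (rule tendsto_absv_le[OF tendsto_F]) (rule absv_F_E_le)
qed

lemma absv_F_power_le:
  assumes "t \<in> \<O>" and "0 < n"
  shows "absv (F i t ^ n) \<le> absv (F i t)"
  using power_decreasing[of 1 n "absv (F i t)"] assms absv_F_le_1[OF assms(1)]
  by (simp add: absv_power)

lemma absv_F_le:
  assumes "t \<in> \<O>"
  shows "absv (F i t) \<le> M ^ i * absv t"
proof (induction i)
  case (Suc i)
  have "absv (F i t ^ CARD('a) - F i t) \<le> M ^ i * absv t"
    using Suc absv_F_power_le[OF assms q_pos, of i] by (intro absv_diff_le) auto
  then show ?case
    using absv_divide_bracket_le[of "Suc i"] by (simp add: F.simps(2) mult.assoc)
qed simp

lemma carlitz_L_Suc: "carlitz_L \<iota> (Suc i) = carlitz_L \<iota> i * br (Suc i)"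
  by (simp add: carlitz_L_def mult.commute)

lemma absv_divide_carlitz_L_le: "absv (z / carlitz_L \<iota> i) \<le> M ^ i * absv z"
proof (induction i)
  case (Suc i)
  then show ?case
    using absv_divide_bracket_le[of "Suc i" "z / carlitz_L \<iota> i"]
    by (simp add: carlitz_L_Suc mult.assoc)
qed (simp add: carlitz_L_def)

lemma absv_F_minus_linear_le:
  assumes "t \<in> \<O>"
  shows "absv (F i t - (- 1) ^ i / carlitz_L \<iota> i * t) \<le> M ^ (2 * i) * absv t ^ 2"
proof (induction i)
  case (Suc i)
  let ?g = "(- 1) ^ i / carlitz_L \<iota> i * t"
  have "absv (F i t ^ CARD('a)) = absv (F i t) ^ CARD('a)" by (rule absv_power)
  also have "\<dots> \<le> absv (F i t) ^ 2"
    using absv_F_le_1[OF assms] q_ge_2 by (intro power_decreasing) auto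
  also have "\<dots> \<le> (M ^ i * absv t) ^ 2"
    by (intro power_mono absv_F_le assms) simp
  finally have "absv (F i t ^ CARD('a)) \<le> M ^ (2 * i) * absv t ^ 2"
    by (simp add: power_mult_distrib power_even_eq)
  then have le: "absv (F i t ^ CARD('a) - (F i t - ?g)) \<le> M ^ (2 * i) * absv t ^ 2"
    using Suc by (rule absv_diff_le)
  have "F (Suc i) t - (- 1) ^ Suc i / carlitz_L \<iota> (Suc i) * t =
      (F i t ^ CARD('a) - (F i t - ?g)) / br (Suc i)"
    by (simp add: F.simps(2) carlitz_L_Suc diff_divide_distrib add_divide_distrib)
  then have "absv (F (Suc i) t - (- 1) ^ Suc i / carlitz_L \<iota> (Suc i) * t) \<le>
      M * (M ^ (2 * i) * absv t ^ 2)"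
    using absv_divide_bracket_le[OF _ le, of "Suc i"] by simp
  also have "\<dots> \<le> M * (M * (M ^ (2 * i) * absv t ^ 2))"
    using M_ge_1 mult_right_mono[OF M_ge_1, of "M * (M ^ (2 * i) * absv t ^ 2)"] by simp
  finally show ?case by (simp add: mult.assoc)
qed (simp add: carlitz_L_def)

lemma carlitz_e_Suc:
  "carlitz_e \<iota> (Suc i) t = (\<Prod>\<alpha>\<in>UNIV. carlitz_e \<iota> i (t - cst \<alpha> * X ^ i))"
proof (cases "i = 0")
  case True
  have "{\<omega> :: 'a poly. degree \<omega> < 1} = (\<lambda>\<alpha>. [:\<alpha>:]) ` UNIV"
    by (auto elim: degree_eq_zeroE)
  then have "carlitz_e \<iota> 1 t = (\<Prod>\<omega>\<in>(\<lambda>\<alpha>. [:\<alpha>:]) ` UNIV. t - E \<omega>)"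
    by (simp add: carlitz_e_def)
  also have "\<dots> = (\<Prod>\<alpha>\<in>UNIV. t - cst \<alpha>)"
    by (subst prod.reindex) (auto simp: inj_def)
  finally show ?thesis using True by (simp add: carlitz_e_def)
next
  case False
  then show ?thesis
    by (simp add: carlitz_e_def prod_degree_less_Suc E_add E_monom diff_diff_eq)
qed

lemma carlitz_e_eq: "carlitz_e \<iota> i t = carlitz_D \<iota> i * F i t"
proof (induction i arbitrary: t)
  case 0
  then show ?case by (simp add: carlitz_e_def carlitz_D_def)
next
  case (Suc i)
  have "carlitz_e \<iota> (Suc i) t = (\<Prod>\<alpha>\<in>UNIV. carlitz_D \<iota> i * (F i t - cst \<alpha>))"
    by (simp add: carlitz_e_Suc Suc F_diff F_cst_mult F_X_power_eq)
  also have "\<dots> = carlitz_D \<iota> i ^ CARD('a) * (F i t ^ CARD('a) - F i t)"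
    by (simp add: prod.distrib prod_diff_cst)
  also have "\<dots> = carlitz_D \<iota> (Suc i) * F (Suc i) t"
    by (simp add: carlitz_D_Suc F_power_q)
  finally show ?case .
qed

lemma carlitz_f_eq: "carlitz_f \<iota> i t = F i t"
  using carlitz_D_nonzero[of i] by (simp add: carlitz_f_def carlitz_e_eq)

lemma carlitz_D_eq_prod:
  assumes "0 < i"
  shows "carlitz_D \<iota> i = (\<Prod>\<omega> | degree \<omega> < i. E (monom 1 i - \<omega>))"
  using carlitz_e_eq[of i "X ^ i"] assms
  by (simp add: F_X_power_eq carlitz_e_def E_diff E_monom)

lemma absv_carlitz_D:
  assumes "i < \<delta>"
  shows "absv (carlitz_D \<iota> i) = 1"
proof (cases "i = 0")
  case True
  then show ?thesis by (simp add: carlitz_D_def)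
next
  case False
  have "absv (E (monom 1 i - \<omega>)) = 1" if "degree \<omega> < i" for \<omega>
  proof (rule absv_E_not_dvd)
    have deg: "degree (monom 1 i - \<omega>) = i"
      using that degree_add_eq_left[of "- \<omega>" "monom 1 i"] by (simp add: degree_monom_eq)
    then have "monom 1 i - \<omega> \<noteq> 0" using False by auto
    then show "\<not> \<pi> dvd monom 1 i - \<omega>"
      using dvd_imp_degree_le[of \<pi> "monom 1 i - \<omega>"] deg assms by auto
  qed
  then show ?thesis using False by (simp add: carlitz_D_eq_prod absv_prod)
qed

lemma absv_bracket_eq_1:
  assumes "0 < i" and "i < \<delta>"
  shows "absv (br i) = 1"
proof -
  obtain j where j: "i = Suc j" using assms(1) by (cases i) auto
  show ?thesis
    using arg_cong[OF carlitz_D_Suc[of j], of absv] absv_carlitz_D[of i] absv_carlitz_D[of j] assms(2)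
    by (simp add: j absv_mult absv_power)
qed

lemma absv_bracket_degree: "absv (br \<delta>) \<le> 1 / M"
proof -
  obtain j where j: "\<delta> = Suc j" using degree_pi_pos by (cases \<delta>) auto
  define \<omega>\<^sub>0 where "\<omega>\<^sub>0 = monom 1 \<delta> - \<pi>"
  have \<omega>\<^sub>0: "degree \<omega>\<^sub>0 < \<delta>"
  proof (rule degree_lessI)
    show "\<forall>k\<ge>\<delta>. coeff \<omega>\<^sub>0 k = 0"
      using monic by (auto simp: \<omega>\<^sub>0_def coeff_eq_0)
  qed (use degree_pi_pos in auto)
  have "absv (carlitz_D \<iota> \<delta>) = (\<Prod>\<omega> | degree \<omega> < \<delta>. absv (E (monom 1 \<delta> - \<omega>)))"
    by (simp add: carlitz_D_eq_prod degree_pi_pos absv_prod)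
  also have "\<dots> = absv (E \<pi>) * (\<Prod>\<omega>\<in>{\<omega>. degree \<omega> < \<delta>} - {\<omega>\<^sub>0}. absv (E (monom 1 \<delta> - \<omega>)))"
    using \<omega>\<^sub>0 by (subst prod.remove[of _ \<omega>\<^sub>0]) (auto simp: finite_degree_less \<omega>\<^sub>0_def)
  also have "\<dots> \<le> 1 / M * 1"
    using absv_E_le_1 M_pos
    by (intro mult_mono prod_le_1) (auto simp: absv_E_pi prod_nonneg)
  finally show ?thesis
    using absv_carlitz_D[of j] by (simp add: j carlitz_D_Suc absv_mult absv_power)
qed

lemma absv_F_le_self:
  assumes "t \<in> \<O>" and "i < \<delta>"
  shows "absv (F i t) \<le> absv t"
  using assms(2)
proof (induction i)
  case (Suc i)
  then have "absv (F i t ^ CARD('a) - F i t) \<le> absv t"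
    using absv_F_power_le[OF assms(1) q_pos, of i] by (intro absv_diff_le) auto
  then show ?case using Suc.prems by (simp add: F.simps(2) absv_divide absv_bracket_eq_1)
qed simp

subsection \<open>Carlitz expansions\<close>

definition carlitz_series :: "(nat \<Rightarrow> 'w) \<Rightarrow> 'w \<Rightarrow> 'w" where
  "carlitz_series c t = (\<Sum>i. c i * F i t)"

lemma carlitz_series_sums:
  assumes c: "(\<lambda>i. absv (c i)) \<longlonglongrightarrow> 0" and t: "t \<in> \<O>"
  shows "(\<lambda>i. c i * F i t) sums carlitz_series c t"
proof -
  have "(\<lambda>i. absv (c i * F i t)) \<longlonglongrightarrow> 0"
    by (rule tendsto_sandwich[OF _ _ tendsto_const c])
      (use absv_F_le_1[OF t] in \<open>auto simp: absv_mult mult_left_le\<close>)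
  then show ?thesis
    unfolding carlitz_series_def by (intro summable_sums summable_null_valued)
qed

lemma carlitz_expansionI:
  assumes c: "(\<lambda>i. absv (c i)) \<longlonglongrightarrow> 0" and u: "\<And>t. t \<in> \<O> \<Longrightarrow> u t = carlitz_series c t"
  shows "carlitz_expansion \<iota> c u"
  unfolding carlitz_expansion_def uniform_limit_iff carlitz_f_eq
proof (intro allI impI)
  fix e :: real assume "0 < e"
  then obtain N where N: "\<And>n. n \<ge> N \<Longrightarrow> absv (c n) < e / 2"
    using order_tendstoD(2)[OF c, of "e / 2"] by (auto simp: eventually_sequentially)
  have "dist (\<Sum>i<n. c i * F i t) (u t) < e" if n: "n \<ge> N" and t: "t \<in> \<O>" for n t
  proof -
    let ?s = "\<lambda>n. \<Sum>i<n. c i * F i t"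
    have "(\<lambda>m. ?s (m + n) - ?s n) \<longlonglongrightarrow> carlitz_series c t - ?s n"
      using carlitz_series_sums[OF c t] unfolding sums_def
      by (intro tendsto_diff tendsto_const LIMSEQ_ignore_initial_segment)
    then have "absv (carlitz_series c t - ?s n) \<le> e / 2"
    proof (rule tendsto_absv_le)
      fix m
      have "?s (m + n) - ?s n = (\<Sum>i\<in>{n..<m + n}. c i * F i t)"
        by (simp add: lessThan_atLeast0 sum_diff_nat_ivl)
      moreover have "absv (c i * F i t) \<le> e / 2" if "i \<in> {n..<m + n}" for i
      proof -
        have "absv (c i * F i t) \<le> absv (c i)"
          using absv_F_le_1[OF t] by (simp add: absv_mult mult_left_le)
        then show ?thesis using N[of i] n that by simp
      qed
      ultimately show "absv (?s (m + n) - ?s n) \<le> e / 2"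
        using \<open>0 < e\<close> by (simp only:) (rule absv_sum_le; simp)
    qed
    then show ?thesis
      using \<open>0 < e\<close> by (simp add: dist_absv u[OF t] absv_minus_commute)
  qed
  then show "\<forall>\<^sub>F n in sequentially. \<forall>t\<in>\<O>. dist (\<Sum>i<n. c i * F i t) (u t) < e"
    by (auto simp: eventually_sequentially)
qed

lemma carlitz_series_add:
  assumes "(\<lambda>i. absv (c i)) \<longlonglongrightarrow> 0" and "s \<in> \<O>" "t \<in> \<O>"
  shows "carlitz_series c (s + t) = carlitz_series c s + carlitz_series c t"
  using sums_add[OF carlitz_series_sums[OF assms(1,2)] carlitz_series_sums[OF assms(1,3)]]
    carlitz_series_sums[OF assms(1) O_add[OF assms(2,3)]]
  by (simp add: F_add distrib_left sums_unique2)

lemma carlitz_series_cst_mult: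
  assumes "(\<lambda>i. absv (c i)) \<longlonglongrightarrow> 0" and "t \<in> \<O>"
  shows "carlitz_series c (cst a * t) = cst a * carlitz_series c t"
  using sums_mult_valued[OF carlitz_series_sums[OF assms], of "cst a"]
    carlitz_series_sums[OF assms(1) O_mult[OF E_in_O assms(2)], of "[:a:]"]
  by (simp add: F_cst_mult mult.left_commute sums_unique2)

lemma carlitz_series_diff:
  assumes "(\<lambda>i. absv (c i)) \<longlonglongrightarrow> 0" and "s \<in> \<O>" "t \<in> \<O>"
  shows "carlitz_series c (s - t) = carlitz_series c s - carlitz_series c t"
  using carlitz_series_add[OF assms(1) O_diff[OF assms(2,3)] assms(3)] by simp

lemma carlitz_series_X_power: "carlitz_series c (X ^ k) = (\<Sum>i\<le>k. c i * F i (X ^ k))"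
  unfolding carlitz_series_def by (rule suminf_finite) (auto simp: F_X_power_less)

lemma carlitz_series_inj:
  assumes "\<And>t. t \<in> \<O> \<Longrightarrow> carlitz_series c t = carlitz_series d t"
  shows "c = d"
proof
  fix k
  show "c k = d k"
  proof (induction k rule: less_induct)
    case (less k)
    have "(\<Sum>i\<le>k. c i * F i (X ^ k)) = (\<Sum>i\<le>k. d i * F i (X ^ k))"
      using assms[OF X_power_in_O[of k]] by (simp only: carlitz_series_X_power)
    moreover have "(\<Sum>i<k. c i * F i (X ^ k)) = (\<Sum>i<k. d i * F i (X ^ k))"
      by (intro sum.cong) (auto simp: less)
    ultimately show ?case by (simp add: F_X_power_eq flip: lessThan_Suc_atMost)
  qed
qed

lemma carlitz_series_Delta_sums:
  assumes "(\<lambda>i. absv (c i)) \<longlonglongrightarrow> 0" and "t \<in> \<O>"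
  shows "(\<lambda>i. c (Suc i) * F i t ^ CARD('a)) sums Delta \<iota> (carlitz_series c) t"
proof -
  have "(\<lambda>i. c i * F i (X * t) - X * (c i * F i t)) sums Delta \<iota> (carlitz_series c) t"
    unfolding Delta_def
    by (intro sums_diff_valued sums_mult_valued carlitz_series_sums O_mult X_in_O assms)
  then have "(\<lambda>i. c (Suc i) * F (Suc i) (X * t) - X * (c (Suc i) * F (Suc i) t)) sums Delta \<iota> (carlitz_series c) t"
    by (subst sums_Suc_iff_valued) (simp add: mult.left_commute)
  then show ?thesis by (simp only: F_X_mult) (simp add: algebra_simps)
qed

subsection \<open>The coefficient relations\<close>

lemma initial_relationD:
  assumes "initial_relations \<pi> \<iota> c" and "1 \<le> i" "i < \<delta>"
  shows "c (Suc i) ^ CARD('a) - c (Suc i) + (br i * c i) ^ CARD('a) = 0"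
  using assms by (simp add: initial_relations_def power_mult_distrib)

lemma initial_relation_1: "initial_relations \<pi> \<iota> c \<Longrightarrow> c 1 ^ CARD('a) - c 1 + 1 = 0"
  unfolding initial_relations_def by blast

lemma absv_initial_le_1:
  assumes "initial_relations \<pi> \<iota> c" and "1 \<le> i" "i \<le> \<delta>"
  shows "absv (c i) \<le> 1"
  using assms(2,3)
proof (induction i rule: dec_induct)
  case base
  show ?case
    by (rule artin_schreier_absv_le[OF initial_relation_1[OF assms(1)]]) simp
next
  case (step i)
  then have "absv ((br i * c i) ^ CARD('a)) \<le> 1"
    using absv_bracket_le_1[of i] by (simp add: absv_power absv_mult power_le_one mult_le_one)
  moreover have "c (Suc i) ^ CARD('a) - c (Suc i) + (br i * c i) ^ CARD('a) = 0"
    using step by (intro initial_relationD[OF assms(1)]) auto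
  ultimately show ?case by (rule artin_schreier_absv_le[rotated])
qed

text \<open>The true decay is doubly exponential. The rate below is what the factors \<open>M ^ (2 * i)\<close> of
  \<open>absv_F_minus_linear_le\<close> require.\<close>

lemma
  assumes init: "initial_relations \<pi> \<iota> c" and high: "higher_relations \<pi> \<iota> c"
  shows absv_coeff_mult_bracket_less: "\<delta> \<le> n \<Longrightarrow> absv (c n * br n) \<le> 1 / M" (is "_ \<Longrightarrow> ?A n")
    and absv_coeff_high: "absv (c (\<delta> + Suc k)) \<le> (1 / M) ^ (2 * Suc k)"
proof -
  have 1: "1 / M < 1" "0 \<le> 1 / M" using M_gt_1 by auto
  have step: "absv (c (Suc n)) \<le> absv (c n * br n) ^ 2" if "\<delta> \<le> n" "?A n" for n
  proof -
    have "(\<lambda>j. (c n * br n) ^ CARD('a) ^ (j + 1)) sums c (Suc n)"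
      using high that by (auto simp: higher_relations_def dest!: spec[of _ "Suc n"])
    then have sums: "(\<lambda>j. ((c n * br n) ^ CARD('a)) ^ CARD('a) ^ j) sums c (Suc n)"
      by (simp flip: power_mult)
    have le_1: "absv (c n * br n) \<le> 1" using that(2) 1 by linarith
    then have le: "absv (((c n * br n) ^ CARD('a)) ^ CARD('a) ^ j) \<le> absv (c n * br n) ^ CARD('a)" for j
      using absv_power_q_le[of "(c n * br n) ^ CARD('a)" j] by (simp add: absv_power power_le_one)
    have "absv (c (Suc n)) \<le> absv (c n * br n) ^ CARD('a)"
      using sums le by (rule sums_absv_le)
    also have "\<dots> \<le> absv (c n * br n) ^ 2"
      using le_1 q_ge_2 by (intro power_decreasing) auto
    finally show ?thesis .
  qed
  have base: "?A \<delta>"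
    using absv_initial_le_1[OF init, of \<delta>] degree_pi_pos absv_bracket_degree
      mult_mono[of "absv (c \<delta>)" 1 "absv (br \<delta>)" "1 / M"]
    by (simp add: absv_mult)
  have br: "absv (c n * br n) \<le> absv (c n)" for n
    using absv_bracket_le_1[of n] by (simp add: absv_mult mult_left_le)
  have high': "absv (c (\<delta> + Suc k)) \<le> (1 / M) ^ (2 * Suc k)" for k
  proof (induction k)
    case 0
    have "absv (c (Suc \<delta>)) \<le> absv (c \<delta> * br \<delta>) ^ 2" using step base by simp
    also have "\<dots> \<le> (1 / M) ^ 2" by (intro power_mono base) simp
    finally show ?case by simp
  next
    case (Suc k)
    let ?n = "\<delta> + Suc k"
    have "(1 / M) ^ (2 * Suc k) \<le> (1 / M) ^ 1" using 1 by (intro power_decreasing) auto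
    then have "?A ?n" using br[of ?n] Suc by simp
    then have "absv (c (Suc ?n)) \<le> absv (c ?n * br ?n) ^ 2" by (intro step) auto
    also have "\<dots> \<le> ((1 / M) ^ (2 * Suc k)) ^ 2"
      using br[of ?n] Suc by (intro power_mono) auto
    also have "\<dots> \<le> (1 / M) ^ (2 * Suc (Suc k))"
      unfolding power_mult[symmetric] using 1 by (intro power_decreasing) auto
    finally show ?case by simp
  qed
  show "absv (c (\<delta> + Suc k)) \<le> (1 / M) ^ (2 * Suc k)" by (rule high')
  show "?A n" if "\<delta> \<le> n"
  proof (cases "n = \<delta>")
    case False
    with that have "\<delta> < n" by simp
    then obtain k where k: "n = \<delta> + Suc k" using less_imp_Suc_add[of \<delta> n] by auto
    have "(1 / M) ^ (2 * Suc k) \<le> (1 / M) ^ 1" using 1 by (intro power_decreasing) auto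
    then show ?thesis using br[of n] high'[of k] unfolding k by simp
  qed (use base in simp)
qed

lemma coeff_relation:
  assumes init: "initial_relations \<pi> \<iota> c" and high: "higher_relations \<pi> \<iota> c" and "1 \<le> n"
  shows "c (Suc n) ^ CARD('a) - c (Suc n) + (br n * c n) ^ CARD('a) = 0"
proof (cases "n < \<delta>")
  case True
  then show ?thesis using initial_relationD[OF init \<open>1 \<le> n\<close>] by simp
next
  case False
  let ?b = "(c n * br n) ^ CARD('a)"
  have "absv (c n * br n) \<le> 1 / M"
    using absv_coeff_mult_bracket_less[OF init high] False by simp
  then have "absv (c n * br n) < 1" using M_gt_1 by (simp add: order_le_less_trans)
  then have "absv ?b < 1" by (simp add: absv_power power_less_one_iff)
  have "(\<lambda>j. (c n * br n) ^ CARD('a) ^ (j + 1)) sums c (Suc n)"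
    using high False by (auto simp: higher_relations_def dest!: spec[of _ "Suc n"])
  then have "c (Suc n) = (\<Sum>j. ?b ^ CARD('a) ^ j)"
    by (simp add: sums_unique flip: power_mult)
  then have "c (Suc n) - c (Suc n) ^ CARD('a) = ?b" using power_q_suminf[OF \<open>absv ?b < 1\<close>] by simp
  then show ?thesis by (simp add: algebra_simps)
qed

lemma absv_coeff_le:
  assumes init: "initial_relations \<pi> \<iota> c" and high: "higher_relations \<pi> \<iota> c" and "1 \<le> n"
  shows "absv (c n) * M ^ (2 * n) \<le> M ^ (2 * \<delta>)"
proof (cases "n \<le> \<delta>")
  case True
  have "absv (c n) * M ^ (2 * n) \<le> 1 * M ^ (2 * \<delta>)"
    using absv_initial_le_1[OF init \<open>1 \<le> n\<close> True] M_ge_1 True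
    by (intro mult_mono power_increasing) auto
  then show ?thesis by simp
next
  case False
  then obtain k where k: "n = \<delta> + Suc k" using less_imp_Suc_add[of \<delta> n] by auto
  have "absv (c n) * M ^ (2 * n) \<le> (1 / M) ^ (2 * Suc k) * M ^ (2 * n)"
    using absv_coeff_high[OF init high, of k] by (intro mult_right_mono) (auto simp: k)
  also have "\<dots> = M ^ (2 * \<delta>)"
  proof -
    have "M ^ (2 * n) = M ^ (2 * Suc k) * M ^ (2 * \<delta>)"
      unfolding power_add[symmetric] k by (intro arg_cong[of _ _ "(^) M"]) simp
    then show ?thesis using M_pos by (simp only: power_one_over) simp
  qed
  finally show ?thesis .
qed

lemma coeff_growth_tendsto:
  assumes init: "initial_relations \<pi> \<iota> c" and high: "higher_relations \<pi> \<iota> c"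
  shows "(\<lambda>n. M ^ n * absv (c n)) \<longlonglongrightarrow> 0"
proof -
  have "(\<lambda>n. M ^ (2 * \<delta>) * (1 / M) ^ n) \<longlonglongrightarrow> M ^ (2 * \<delta>) * 0"
    using M_gt_1 by (intro tendsto_mult tendsto_const LIMSEQ_power_zero) simp
  then have lim: "(\<lambda>n. M ^ (2 * \<delta>) * (1 / M) ^ n) \<longlonglongrightarrow> 0" by simp
  have le: "M ^ n * absv (c n) \<le> M ^ (2 * \<delta>) * (1 / M) ^ n" if "1 \<le> n" for n
  proof -
    have "M ^ n * absv (c n) = absv (c n) * M ^ (2 * n) * (1 / M) ^ n"
      using M_pos by (simp only: power_one_over mult_2 power_add) (simp add: field_simps)
    also have "\<dots> \<le> M ^ (2 * \<delta>) * (1 / M) ^ n"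
      using absv_coeff_le[OF init high that] M_pos by (intro mult_right_mono) auto
    finally show ?thesis .
  qed
  show ?thesis
  proof (rule tendsto_sandwich[OF _ _ tendsto_const lim])
    show "\<forall>\<^sub>F n in sequentially. M ^ n * absv (c n) \<le> M ^ (2 * \<delta>) * (1 / M) ^ n"
      using eventually_ge_at_top[of 1] by eventually_elim (rule le)
  qed (use M_pos in auto)
qed

lemma coeff_tendsto:
  assumes init: "initial_relations \<pi> \<iota> c" and high: "higher_relations \<pi> \<iota> c"
  shows "(\<lambda>n. absv (c n)) \<longlonglongrightarrow> 0"
proof (rule tendsto_sandwich[OF _ _ tendsto_const coeff_growth_tendsto[OF init high]])
  have "absv (c n) \<le> M ^ n * absv (c n)" for n
    using mult_right_mono[OF one_le_power[OF M_ge_1, of n], of "absv (c n)"] by simp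
  then show "\<forall>\<^sub>F n in sequentially. absv (c n) \<le> M ^ n * absv (c n)" by simp
qed simp

subsection \<open>The equation for Carlitz expansions\<close>

lemma Delta_carlitz_series_equation:
  assumes init: "initial_relations \<pi> \<iota> c" and high: "higher_relations \<pi> \<iota> c" and t: "t \<in> \<O>"
  shows "Delta \<iota> (carlitz_series c) t ^ CARD('a) - Delta \<iota> (carlitz_series c) t + t ^ CARD('a) = 0"
proof -
  let ?w = "\<lambda>n. \<Sum>i<n. c (Suc i) * F i t ^ CARD('a)"
  have lim: "?w \<longlonglongrightarrow> Delta \<iota> (carlitz_series c) t"
    using carlitz_series_Delta_sums[OF coeff_tendsto[OF init high] t] by (simp add: sums_def)
  have part: "?w (Suc n) ^ CARD('a) - ?w (Suc n) + t ^ CARD('a) = (br (Suc n) * c (Suc n) * F (Suc n) t) ^ CARD('a)" for n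
  proof (induction n)
    case 0
    have c: "c (Suc 0) ^ CARD('a) = c (Suc 0) - 1" using initial_relation_1[OF init] by (simp add: algebra_simps)
    have "(t ^ CARD('a)) ^ CARD('a) = t ^ CARD('a) + (br 1 * F 1 t) ^ CARD('a)"
      using F_power_q[of 0 t] unfolding F.simps One_nat_def by (metis frobenius_add)
    then have "?w (Suc 0) ^ CARD('a) - ?w (Suc 0) + t ^ CARD('a) =
        c 1 ^ CARD('a) * (t ^ CARD('a) + (br 1 * F 1 t) ^ CARD('a)) - c 1 * t ^ CARD('a) + t ^ CARD('a)"
      by (simp add: power_mult_distrib)
    also have "\<dots> = c 1 ^ CARD('a) * (br 1 * F 1 t) ^ CARD('a)"
      by (simp add: c algebra_simps)
    finally show ?case by (simp add: power_mult_distrib)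
  next
    case (Suc n)
    let ?n = "Suc n"
    have c: "c (Suc ?n) ^ CARD('a) = c (Suc ?n) - (br ?n * c ?n) ^ CARD('a)"
      using coeff_relation[OF init high, of ?n] by (simp add: algebra_simps)
    have F: "(F ?n t ^ CARD('a)) ^ CARD('a) = F ?n t ^ CARD('a) + (br (Suc ?n) * F (Suc ?n) t) ^ CARD('a)"
      using F_power_q[of ?n t] by (metis frobenius_add)
    have "?w (Suc ?n) ^ CARD('a) - ?w (Suc ?n) + t ^ CARD('a) =
        (?w ?n ^ CARD('a) - ?w ?n + t ^ CARD('a)) + c (Suc ?n) ^ CARD('a) * (F ?n t ^ CARD('a)) ^ CARD('a) - c (Suc ?n) * F ?n t ^ CARD('a)"
      by (simp add: frobenius_add power_mult_distrib)
    also have "\<dots> = c (Suc ?n) ^ CARD('a) * (br (Suc ?n) * F (Suc ?n) t) ^ CARD('a)"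
      unfolding Suc F by (simp add: c power_mult_distrib algebra_simps)
    finally show ?case by (simp add: power_mult_distrib mult_ac)
  qed
  have "(\<lambda>n. (br (Suc n) * c (Suc n) * F (Suc n) t) ^ CARD('a)) \<longlonglongrightarrow> 0"
  proof (rule tendsto_absv_diffI)
    show "(\<lambda>n. absv (c (Suc n)) ^ CARD('a)) \<longlonglongrightarrow> 0"
      using tendsto_power[OF LIMSEQ_Suc[OF coeff_tendsto[OF init high]], of "CARD('a)"] by (simp add: zero_power)
    show "absv ((br (Suc n) * c (Suc n) * F (Suc n) t) ^ CARD('a) - 0) \<le> absv (c (Suc n)) ^ CARD('a)" for n
    proof -
      have "absv (br (Suc n)) * absv (c (Suc n)) * absv (F (Suc n) t) \<le> 1 * absv (c (Suc n)) * 1"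
        by (intro mult_mono absv_bracket_le_1 absv_F_le_1 t) auto
      then show ?thesis by (simp add: absv_power absv_mult power_mono)
    qed
  qed
  moreover have "(\<lambda>n. (br (Suc n) * c (Suc n) * F (Suc n) t) ^ CARD('a))
      \<longlonglongrightarrow> Delta \<iota> (carlitz_series c) t ^ CARD('a) - Delta \<iota> (carlitz_series c) t + t ^ CARD('a)"
    unfolding part[symmetric]
    by (intro tendsto_add tendsto_diff tendsto_const tendsto_power_valued LIMSEQ_Suc[OF lim])
  ultimately show ?thesis by (rule LIMSEQ_unique[symmetric])
qed

lemma absv_carlitz_series_le:
  assumes init: "initial_relations \<pi> \<iota> c" and high: "higher_relations \<pi> \<iota> c"
    and zeroth: "zeroth_relation \<iota> c" and t: "t \<in> \<O>"
  shows "absv (carlitz_series c t) \<le> M ^ (2 * \<delta>) * absv t ^ 2"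
proof -
  let ?g = "\<lambda>i. (- 1) ^ i / carlitz_L \<iota> i"
  have "(\<lambda>i. - (c (Suc i) * ?g (Suc i))) sums c 0"
    using zeroth by (simp add: zeroth_relation_def mult.commute)
  from sums_mult_valued[OF sums_minus_valued[OF this], of t]
  have "(\<lambda>i. t * (c (Suc i) * ?g (Suc i))) sums (- (c 0 * t))" by (simp add: mult.commute)
  moreover have "(\<lambda>i. c (Suc i) * F (Suc i) t) sums (carlitz_series c t - c 0 * t)"
    using carlitz_series_sums[OF coeff_tendsto[OF init high] t] by (subst sums_Suc_iff_valued) simp
  ultimately have
    "(\<lambda>i. c (Suc i) * F (Suc i) t - t * (c (Suc i) * ?g (Suc i))) sums (carlitz_series c t - c 0 * t - - (c 0 * t))"
    by (intro sums_diff_valued)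
  then have "(\<lambda>i. c (Suc i) * (F (Suc i) t - ?g (Suc i) * t)) sums carlitz_series c t"
    by (simp add: algebra_simps)
  then show ?thesis
  proof (rule sums_absv_le)
    fix i
    let ?n = "Suc i"
    have "absv (c ?n * (F ?n t - ?g ?n * t)) \<le> absv (c ?n) * (M ^ (2 * ?n) * absv t ^ 2)"
      unfolding absv_mult by (intro mult_left_mono absv_F_minus_linear_le t) simp
    also have "\<dots> \<le> M ^ (2 * \<delta>) * absv t ^ 2"
      using mult_right_mono[OF absv_coeff_le[OF init high, of ?n], of "absv t ^ 2"]
      by (simp add: mult.assoc)
    finally show "absv (c ?n * (F ?n t - ?g ?n * t)) \<le> M ^ (2 * \<delta>) * absv t ^ 2" .
  qed
qed

subsection \<open>The behaviour near zero\<close>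

lemma O_if_small: "t \<in> K \<Longrightarrow> absv t \<le> 1 / M \<Longrightarrow> t \<in> \<O>"
  using M_gt_1 by (auto simp: O_pi_def intro: order_trans)

lemma absv_less_1_if_small: "absv t \<le> 1 / M \<Longrightarrow> absv (t :: 'w) < 1"
proof -
  have "1 / M < 1" using M_gt_1 by simp
  then show "absv t \<le> 1 / M \<Longrightarrow> absv t < 1" by (rule order_le_less_trans[rotated])
qed

lemma small_series_term_le:
  assumes "absv t \<le> 1"
  shows "absv (t ^ CARD('a) ^ Suc n / br (Suc n)) \<le> M * absv t ^ 2"
proof (rule absv_divide_bracket_le)
  have "2 \<le> CARD('a) ^ Suc n"
    using q_ge_2 by (intro order_trans[OF q_ge_2 self_le_power]) auto
  then show "absv (t ^ CARD('a) ^ Suc n) \<le> absv t ^ 2"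
    using assms unfolding absv_power by (intro power_decreasing) auto
qed simp

lemma small_series_summable:
  assumes "absv t < 1"
  shows "summable (\<lambda>n. t ^ CARD('a) ^ Suc n / br (Suc n))"
proof (rule summable_null_valued)
  have "(\<lambda>n. M * absv (t ^ CARD('a) ^ Suc n)) \<longlonglongrightarrow> M * 0"
    by (intro tendsto_mult tendsto_const LIMSEQ_Suc absv_power_q_tendsto assms)
  then have lim: "(\<lambda>n. M * absv (t ^ CARD('a) ^ Suc n)) \<longlonglongrightarrow> 0" by simp
  show "(\<lambda>n. absv (t ^ CARD('a) ^ Suc n / br (Suc n))) \<longlonglongrightarrow> 0"
    by (rule tendsto_sandwich[OF _ _ tendsto_const lim])
      (auto intro!: always_eventually absv_divide_bracket_le)
qed

text \<open>Near zero \<open>Delta\<close> is small, which singles out one root of the equation, so the difference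
  \<open>h\<close> of the two sides commutes with multiplication by \<open>\<pi>\<close>. The relation for \<open>c 0\<close> removes the linear
  term, whence \<open>h t = O(t\<^sup>2)\<close>, and scaling by powers of \<open>\<pi>\<close> forces \<open>h = 0\<close>.\<close>

lemma carlitz_series_near_zero:
  assumes init: "initial_relations \<pi> \<iota> c" and high: "higher_relations \<pi> \<iota> c"
    and zeroth: "zeroth_relation \<iota> c" and t: "t \<in> K" "absv t \<le> 1 / M"
  shows "(\<lambda>n. t ^ CARD('a) ^ Suc n / br (Suc n)) sums carlitz_series c t"
proof -
  let ?I = "{t \<in> K. absv t \<le> 1 / M}"
  define U where "U t = (\<Sum>n. t ^ CARD('a) ^ Suc n / br (Suc n))" for t
  note null = coeff_tendsto[OF init high]
  have M1: "1 / M < 1" using M_gt_1 by simp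
  have U: "(\<lambda>n. t ^ CARD('a) ^ Suc n / br (Suc n)) sums U t" if "t \<in> ?I" for t
    unfolding U_def using that
    by (intro summable_sums small_series_summable) (auto intro: absv_less_1_if_small)
  have I_mult: "E p * t \<in> ?I" if "t \<in> ?I" for p t
    using that absv_E_le_1[of p] mult_mono[of "absv (E p)" 1 "absv t" "1 / M"]
    by (auto simp: K_E_mult absv_mult)
  have I_O: "t \<in> \<O>" if "t \<in> ?I" for t using that O_if_small by blast
  have I_add: "s + t \<in> ?I" if "s \<in> ?I" "t \<in> ?I" for s t
    using that by (auto simp: K_add absv_add_le)
  define h where "h t = carlitz_series c t - U t" for t
  have h_add: "h (s + t) = h s + h t" if "s \<in> ?I" "t \<in> ?I" for s t
  proof -
    have "U (s + t) = U s + U t"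
      using sums_add[OF U[OF that(1)] U[OF that(2)]] U[OF I_add[OF that]]
      by (simp add: frobenius_iter_add add_divide_distrib sums_unique2 del: power_Suc)
    then show ?thesis using that by (simp add: h_def carlitz_series_add[OF null] I_O)
  qed
  have h_cst: "h (cst a * t) = cst a * h t" if "t \<in> ?I" for a t
  proof -
    have "U (cst a * t) = cst a * U t"
      using sums_mult_valued[OF U[OF that], of "cst a"] U[OF I_mult[OF that], of "[:a:]"]
      by (simp add: power_mult_distrib cst_power_q_iter sums_unique2 del: power_Suc)
    then show ?thesis using that by (simp add: h_def carlitz_series_cst_mult[OF null] I_O right_diff_distrib)
  qed
  have h_X: "h (X * t) = X * h t" if tI: "t \<in> ?I" for t
  proof -
    have Xt: "X * t \<in> ?I" using I_mult[OF tI, of "[:0, 1:]"] by (simp add: var_x_def)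
    have small: "absv t < 1" using tI absv_less_1_if_small by blast
    have "(\<lambda>n. (X * t) ^ CARD('a) ^ Suc n / br (Suc n) - X * (t ^ CARD('a) ^ Suc n / br (Suc n)))
        sums (U (X * t) - X * U t)"
      by (intro sums_diff_valued sums_mult_valued U tI Xt)
    moreover have "(X * t) ^ CARD('a) ^ Suc n / br (Suc n) - X * (t ^ CARD('a) ^ Suc n / br (Suc n)) = t ^ CARD('a) ^ Suc n" for n
    proof -
      have "(X * t) ^ CARD('a) ^ Suc n / br (Suc n) - X * (t ^ CARD('a) ^ Suc n / br (Suc n)) =
          br (Suc n) * t ^ CARD('a) ^ Suc n / br (Suc n)"
        by (simp add: bracket_def power_mult_distrib left_diff_distrib diff_divide_distrib del: power_Suc)
      then show ?thesis using bracket_nonzero[of "Suc n"] by (simp del: power_Suc)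
    qed
    ultimately have U_X: "(\<lambda>n. t ^ CARD('a) ^ Suc n) sums (U (X * t) - X * U t)" by (simp only:)
    have "absv (Delta \<iota> (carlitz_series c) t) \<le> 1 / M"
    proof (rule sums_absv_le[OF carlitz_series_Delta_sums[OF null I_O[OF tI]]])
      fix i
      show "absv (c (Suc i) * F i t ^ CARD('a)) \<le> 1 / M"
      proof (cases "i < \<delta>")
        case True
        have "absv (F i t ^ CARD('a)) \<le> 1 / M"
          using absv_F_power_le[OF I_O[OF tI] q_pos, of i] absv_F_le_self[OF I_O[OF tI] True] tI by simp
        then have "absv (c (Suc i)) * absv (F i t ^ CARD('a)) \<le> 1 * (1 / M)"
          using absv_initial_le_1[OF init, of "Suc i"] True by (intro mult_mono) auto
        then show ?thesis by (simp add: absv_mult)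
      next
        case False
        then obtain k where k: "Suc i = \<delta> + Suc k" using less_imp_Suc_add[of \<delta> "Suc i"] by auto
        have "(1 / M) ^ (2 * Suc k) \<le> (1 / M) ^ 1" using M1 M_pos by (intro power_decreasing) auto
        then have "absv (c (Suc i)) \<le> 1 / M"
          using absv_coeff_high[OF init high, of k] unfolding k by simp
        moreover have "absv (F i t ^ CARD('a)) \<le> 1"
          using absv_F_le_1[OF I_O[OF tI]] by (simp add: absv_power power_le_one)
        ultimately have "absv (c (Suc i)) * absv (F i t ^ CARD('a)) \<le> 1 / M * 1"
          by (intro mult_mono) auto
        then show ?thesis by (simp add: absv_mult)
      qed
    qed
    then have "absv (Delta \<iota> (carlitz_series c) t) < 1" by (rule absv_less_1_if_small)
    moreover have "Delta \<iota> (carlitz_series c) t - Delta \<iota> (carlitz_series c) t ^ CARD('a) = t ^ CARD('a)"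
      using Delta_carlitz_series_equation[OF init high I_O[OF tI]] by (simp add: algebra_simps)
    moreover have "absv (t ^ CARD('a)) < 1" using small by (simp add: absv_power power_less_one_iff)
    ultimately have "(\<lambda>n. (t ^ CARD('a)) ^ CARD('a) ^ n) sums Delta \<iota> (carlitz_series c) t"
      by (intro sums_power_q_unique)
    then have "(\<lambda>n. t ^ CARD('a) ^ Suc n) sums Delta \<iota> (carlitz_series c) t" by (simp flip: power_mult)
    with U_X have "U (X * t) - X * U t = carlitz_series c (X * t) - X * carlitz_series c t"
      unfolding Delta_def by (rule sums_unique2)
    then show ?thesis by (simp add: h_def algebra_simps)
  qed
  have h_E: "h (E p * t) = E p * h t" if tI: "t \<in> ?I" for p t
  proof (induction p)
    case 0
    show ?case using h_cst[OF tI, of 0] by simp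
  next
    case (pCons a p)
    have "X * (E p * t) \<in> ?I"
      using I_mult[OF I_mult[OF tI], of "[:0, 1:]" p] by (simp only: var_x_def)
    then have "h (cst a * t + X * (E p * t)) = cst a * h t + X * (E p * h t)"
      by (simp only: h_add[OF I_mult[OF tI]] h_cst[OF tI] h_X[OF I_mult[OF tI]] pCons)
    then show ?case by (subst (1 2) E_pCons) (simp add: algebra_simps)
  qed
  have h_le: "absv (h t) \<le> M ^ (2 * \<delta>) * absv t ^ 2" if tI: "t \<in> ?I" for t
  proof -
    have t1: "absv t \<le> 1" using I_O[OF tI] by (rule absv_le_1_O)
    have "absv (U t) \<le> M * absv t ^ 2"
      by (rule sums_absv_le[OF U[OF tI]]) (rule small_series_term_le[OF t1])
    also have "\<dots> \<le> M ^ (2 * \<delta>) * absv t ^ 2"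
      using power_increasing[of 1 "2 * \<delta>" M] degree_pi_pos M_ge_1 by (intro mult_right_mono) auto
    finally show ?thesis
      unfolding h_def using absv_carlitz_series_le[OF init high zeroth I_O[OF tI]] by (rule absv_diff_le[rotated])
  qed
  have tI: "t \<in> ?I" using t by simp
  have bound: "absv (h t) \<le> M ^ (2 * \<delta>) * absv t ^ 2 * (1 / M) ^ k" for k
  proof -
    have "(1 / M) ^ k * absv (h t) = absv (h (E (\<pi> ^ k) * t))"
      unfolding h_E[OF tI] by (simp add: E_power absv_mult absv_power absv_E_pi)
    also have "\<dots> \<le> M ^ (2 * \<delta>) * absv (E (\<pi> ^ k) * t) ^ 2"
      by (intro h_le I_mult tI)
    also have "\<dots> = (1 / M) ^ k * (M ^ (2 * \<delta>) * absv t ^ 2 * (1 / M) ^ k)"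
      by (simp add: E_power absv_mult absv_power absv_E_pi power2_eq_square)
    finally show ?thesis using M_pos by (subst (asm) mult_le_cancel_left_pos) auto
  qed
  have "(\<lambda>k. M ^ (2 * \<delta>) * absv t ^ 2 * (1 / M) ^ k) \<longlonglongrightarrow> M ^ (2 * \<delta>) * absv t ^ 2 * 0"
    using M1 M_pos by (intro tendsto_mult tendsto_const LIMSEQ_power_zero) auto
  then have "absv (h t) \<le> M ^ (2 * \<delta>) * absv t ^ 2 * 0"
    by (rule LIMSEQ_le_const) (use bound in auto)
  then have "h t = 0" using absv_nonneg[of "h t"] by (simp add: order_antisym_conv)
  then show ?thesis using U[OF tI] by (simp add: h_def)
qed

subsection \<open>Solutions\<close>

lemma carlitz_d_eqI:
  assumes "z ^ CARD('a) = Delta \<iota> u t"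
  shows "carlitz_d \<iota> u t = z"
  unfolding carlitz_d_def using assms by (intro the_equality) (auto intro: frobenius_inj)

lemma carlitz_series_in_solutions:
  assumes init: "initial_relations \<pi> \<iota> c" and high: "higher_relations \<pi> \<iota> c"
    and zeroth: "zeroth_relation \<iota> c"
  shows "restrict (carlitz_series c) \<O> \<in> solutions \<pi> \<iota>"
proof -
  let ?u = "restrict (carlitz_series c) \<O>"
  note null = coeff_tendsto[OF init high]
  have "continuous_on \<O> ?u"
  proof (subst continuous_on_iff, intro ballI allI impI)
    fix t and e :: real assume t: "t \<in> \<O>" and "0 < e"
    have M: "0 < M ^ (2 * \<delta>)" using M_pos by simp
    have "dist (?u s) (?u t) < e"
      if s: "s \<in> \<O>" and d: "dist s t < e / M ^ (2 * \<delta>)" for s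
    proof -
      have st: "s - t \<in> \<O>" by (intro O_diff s t)
      have "absv (carlitz_series c (s - t)) \<le> M ^ (2 * \<delta>) * absv (s - t) ^ 2"
        by (rule absv_carlitz_series_le[OF init high zeroth st])
      also have "\<dots> \<le> M ^ (2 * \<delta>) * absv (s - t) ^ 1"
        using absv_le_1_O[OF st] M by (intro mult_left_mono power_decreasing) auto
      also have "\<dots> < e" using d M by (simp add: dist_absv field_simps)
      finally show ?thesis by (simp add: s t dist_absv carlitz_series_diff[OF null])
    qed
    then show "\<exists>d>0. \<forall>s\<in>\<O>. dist s t < d \<longrightarrow> dist (?u s) (?u t) < e"
      using \<open>0 < e\<close> M by (intro exI[of _ "e / M ^ (2 * \<delta>)"]) auto
  qed
  moreover have "Fq_linear_on \<iota> \<O> ?u"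
    unfolding Fq_linear_on_def
    by (auto simp: carlitz_series_add[OF null] carlitz_series_cst_mult[OF null] O_add O_mult E_in_O)
  moreover have "carlitz_d \<iota> ?u t - tau \<iota> (carlitz_d \<iota> ?u) t = t" if t: "t \<in> \<O>" for t
  proof -
    have D: "Delta \<iota> ?u t = Delta \<iota> (carlitz_series c) t"
      by (simp add: Delta_def t O_mult X_in_O)
    have "(Delta \<iota> (carlitz_series c) t + t) ^ CARD('a) = Delta \<iota> (carlitz_series c) t"
      using Delta_carlitz_series_equation[OF init high t] by (simp add: frobenius_add algebra_simps)
    then have "carlitz_d \<iota> ?u t = Delta \<iota> (carlitz_series c) t + t" and "(Delta \<iota> (carlitz_series c) t + t) ^ CARD('a) = Delta \<iota> (carlitz_series c) t"
      by (auto intro: carlitz_d_eqI simp: D)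
    then show ?thesis by (simp add: tau_def)
  qed
  moreover have "(\<lambda>n. t ^ CARD('a) ^ Suc n / br (Suc n)) sums ?u t" if "t \<in> K" "absv t \<le> 1 / M" for t
    using carlitz_series_near_zero[OF init high zeroth that] O_if_small[OF that] by simp
  ultimately show ?thesis by (simp add: solutions_def)
qed

lemma solution_Delta_equation:
  assumes u: "u \<in> solutions \<pi> \<iota>" and t: "t \<in> \<O>"
  shows "Delta \<iota> u t ^ CARD('a) - Delta \<iota> u t + t ^ CARD('a) = 0"
proof -
  obtain y where y: "y ^ CARD('a) = Delta \<iota> u t" using root_q_exists .
  then have "y - y ^ CARD('a) = t"
    using u t carlitz_d_eqI[OF y] by (auto simp: solutions_def tau_def)
  then have "y = Delta \<iota> u t + t" using y by (simp add: algebra_simps)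
  then have "Delta \<iota> u t ^ CARD('a) + t ^ CARD('a) = Delta \<iota> u t" using y by (simp add: frobenius_add)
  then show ?thesis by (simp add: algebra_simps)
qed

text \<open>The difference of two solutions with equal values of \<open>Delta\<close> at the powers of x satisfies
  \<open>h (x\<^sup>i) = x\<^sup>i * h 1\<close> up to \<open>i = \<delta>\<close>, so \<open>\<pi> * h 1 = h \<pi> = 0\<close>.\<close>

lemma solutions_eqI:
  assumes u: "u \<in> solutions \<pi> \<iota>" and v: "v \<in> solutions \<pi> \<iota>"
    and eq: "\<And>i. i < \<delta> \<Longrightarrow> Delta \<iota> u (X ^ i) = Delta \<iota> v (X ^ i)"
  shows "u = v"
proof -
  define h where "h t = u t - v t" for t
  have h_add: "h (s + t) = h s + h t" if "s \<in> \<O>" "t \<in> \<O>" for s t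
    using u v that by (simp add: h_def solutions_def Fq_linear_on_def)
  have h_cst: "h (cst a * t) = cst a * h t" if "t \<in> \<O>" for a t
    using u v that by (simp add: h_def solutions_def Fq_linear_on_def right_diff_distrib)
  have h_small: "h t = 0" if "t \<in> K" "absv t \<le> 1 / M" for t
  proof -
    have "(\<lambda>n. t ^ CARD('a) ^ Suc n / br (Suc n)) sums u t" "(\<lambda>n. t ^ CARD('a) ^ Suc n / br (Suc n)) sums v t"
      using u v that unfolding solutions_def by blast+
    then have "u t = v t" by (rule sums_unique2)
    then show ?thesis by (simp add: h_def)
  qed
  have h_X: "h (X ^ i) = X ^ i * h 1" if "i \<le> \<delta>" for i
    using that
  proof (induction i)
    case (Suc i)
    then have "h (X ^ Suc i) = X * h (X ^ i)"
      using eq[of i] by (simp add: h_def Delta_def algebra_simps)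
    then show ?case using Suc by simp
  qed simp
  have h_E: "h (E p) = E p * h 1" if "degree p \<le> \<delta>" for p
  proof -
    have sum: "E p = (\<Sum>i\<le>\<delta>. cst (coeff p i) * X ^ i)"
      using poly_as_sum_of_monoms'[OF that] by (metis (no_types, lifting) E_monom E_sum sum.cong)
    have h_sum: "h (\<Sum>i\<in>A. cst (coeff p i) * X ^ i) = (\<Sum>i\<in>A. cst (coeff p i) * h (X ^ i))"
      if "finite A" for A
      using that
    proof (induction A rule: finite_induct)
      case empty
      then show ?case using h_cst[OF zero_in_O, of 0] by simp
    next
      case (insert i A)
      have "(\<Sum>i\<in>A. cst (coeff p i) * X ^ i) \<in> \<O>" and "cst (coeff p i) * X ^ i \<in> \<O>"
        by (auto intro: O_sum O_mult E_in_O X_power_in_O)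
      then show ?case using insert by (simp add: h_add h_cst X_power_in_O)
    qed
    show ?thesis
      unfolding sum by (simp add: h_sum h_X sum_distrib_right mult.assoc)
  qed
  have "h (E \<pi>) = 0"
    by (intro h_small E_in_K absv_E_dvd) simp
  then have h_1: "h 1 = 0" using h_E[of \<pi>] pi_nonzero by simp
  have "u t = v t" if t: "t \<in> \<O>" for t
  proof -
    obtain r where r: "degree r < \<delta>" "absv (t - E r) \<le> 1 / M" using O_residue[OF t] .
    have "h (E r + (t - E r)) = h (E r) + h (t - E r)"
      by (intro h_add E_in_O O_diff t)
    also have "\<dots> = 0"
      using r t h_E[of r] by (simp add: h_1 h_small K_diff E_in_K O_pi_def)
    finally show ?thesis by (simp add: h_def)
  qed
  then show "u = v"
    using u v by (intro PiE_ext[of u \<O> "\<lambda>_. UNIV" v]) (auto simp: solutions_def)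
qed

lemma solutions_inj_on:
  "inj_on (\<lambda>u. \<lambda>i\<in>{..<\<delta>}. Delta \<iota> u (X ^ i)) (solutions \<pi> \<iota>)"
proof (rule inj_onI)
  fix u v assume uv: "u \<in> solutions \<pi> \<iota>" "v \<in> solutions \<pi> \<iota>"
    and eq: "(\<lambda>i\<in>{..<\<delta>}. Delta \<iota> u (X ^ i)) = (\<lambda>i\<in>{..<\<delta>}. Delta \<iota> v (X ^ i))"
  have "Delta \<iota> u (X ^ i) = Delta \<iota> v (X ^ i)" if "i < \<delta>" for i
    using fun_cong[OF eq, of i] that by simp
  with uv show "u = v" by (rule solutions_eqI)
qed

lemma finite_solutions: "finite (solutions \<pi> \<iota>)"
  and card_solutions_le: "card (solutions \<pi> \<iota>) \<le> CARD('a) ^ \<delta>"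
proof -
  let ?P = "Pi\<^sub>E {..<\<delta>} (\<lambda>i. {z. z ^ CARD('a) - z + (X ^ i) ^ CARD('a) = 0})"
  have sub: "(\<lambda>u. \<lambda>i\<in>{..<\<delta>}. Delta \<iota> u (X ^ i)) ` solutions \<pi> \<iota> \<subseteq> ?P"
    using solution_Delta_equation[OF _ X_power_in_O] by (auto split: if_splits)
  have card: "card ?P = CARD('a) ^ \<delta>" by (simp add: card_PiE card_artin_schreier)
  then have fin: "finite ?P" by (intro card_ge_0_finite) simp
  show "finite (solutions \<pi> \<iota>)"
    using inj_on_finite[OF solutions_inj_on sub fin] .
  show "card (solutions \<pi> \<iota>) \<le> CARD('a) ^ \<delta>"
    using card_inj_on_le[OF solutions_inj_on sub fin] card by simp
qed

subsection \<open>Initial coefficients\<close>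

primrec tail_coeff :: "'w \<Rightarrow> nat \<Rightarrow> 'w" where
  "tail_coeff a 0 = a"
| "tail_coeff a (Suc k) = (\<Sum>j. ((tail_coeff a k * br (\<delta> + k)) ^ CARD('a)) ^ CARD('a) ^ j)"

lemma absv_tail_coeff:
  assumes "absv a \<le> 1"
  shows "absv (tail_coeff a k * br (\<delta> + k)) < 1"
proof (induction k)
  case 0
  have "absv a * absv (br \<delta>) \<le> 1 * (1 / M)"
    using assms absv_bracket_degree by (intro mult_mono) auto
  then show ?case by (intro absv_less_1_if_small) (simp add: absv_mult)
next
  case (Suc k)
  let ?b = "(tail_coeff a k * br (\<delta> + k)) ^ CARD('a)"
  have b: "absv ?b < 1" unfolding absv_power using Suc by (subst power_less_one_iff) auto
  have "absv (tail_coeff a (Suc k)) < 1"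
    using order_le_less_trans[OF suminf_power_q_absv_le[OF b] b] by simp
  moreover have "absv (tail_coeff a (Suc k) * br (\<delta> + Suc k)) \<le> absv (tail_coeff a (Suc k))"
    using absv_bracket_le_1 by (simp only: absv_mult mult_left_le absv_nonneg)
  ultimately show ?case by (rule order_le_less_trans[rotated])
qed

lemma initial_relations_cong:
  assumes "initial_relations \<pi> \<iota> c" and "\<And>i. i \<in> {1..\<delta>} \<Longrightarrow> d i = c i"
  shows "initial_relations \<pi> \<iota> d"
  using assms degree_pi_pos by (auto simp: initial_relations_def)

lemma extend_coefficients:
  assumes init: "initial_relations \<pi> \<iota> a"
  shows "\<exists>c. (\<forall>i\<in>{1..\<delta>}. c i = a i) \<and> initial_relations \<pi> \<iota> c \<and> higher_relations \<pi> \<iota> c \<and>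
    zeroth_relation \<iota> c"
proof -
  define b where "b n = (if n \<le> \<delta> then a n else tail_coeff (a \<delta>) (n - \<delta>))" for n
  have b_high: "b (\<delta> + k) = tail_coeff (a \<delta>) k" for k
    by (cases k) (auto simp: b_def)
  have high: "higher_relations \<pi> \<iota> d" if "\<And>n. 1 \<le> n \<Longrightarrow> d n = b n" for d
    unfolding higher_relations_def
  proof (intro allI impI)
    fix n assume n: "\<delta> + 1 \<le> n"
    then obtain k where k: "n = Suc (\<delta> + k)" by (auto dest: le_Suc_ex)
    let ?b = "(tail_coeff (a \<delta>) k * br (\<delta> + k)) ^ CARD('a)"
    have d: "d (\<delta> + k) = tail_coeff (a \<delta>) k" "d (Suc (\<delta> + k)) = tail_coeff (a \<delta>) (Suc k)"
      using that[of "\<delta> + k"] that[of "\<delta> + Suc k"] degree_pi_pos b_high[of k] b_high[of "Suc k"]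
      by simp_all
    have "absv ?b < 1"
      unfolding absv_power
      using absv_tail_coeff[of "a \<delta>" k] absv_initial_le_1[OF init, of \<delta>] degree_pi_pos
      by (subst power_less_one_iff) auto
    from summable_sums[OF summable_power_q[OF this]]
    have "(\<lambda>j. ?b ^ CARD('a) ^ j) sums d n" unfolding k d(2) by simp
    then show "(\<lambda>j. (d (n - 1) * br (n - 1)) ^ CARD('a) ^ (j + 1)) sums d n"
      unfolding k by (simp add: d flip: power_mult)
  qed
  have init_b: "initial_relations \<pi> \<iota> b"
    by (rule initial_relations_cong[OF init]) (simp add: b_def)
  let ?z = "\<lambda>i. (- 1) ^ (Suc i + 1) * (b (Suc i) / carlitz_L \<iota> (Suc i))"
  have "(\<lambda>i. absv (?z i)) \<longlonglongrightarrow> 0"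
  proof (rule tendsto_sandwich[OF _ _ tendsto_const])
    show "(\<lambda>i. M ^ Suc i * absv (b (Suc i))) \<longlonglongrightarrow> 0"
      by (intro LIMSEQ_Suc coeff_growth_tendsto init_b high) simp
    have "absv (?z i) \<le> M ^ Suc i * absv (b (Suc i))" for i
      using absv_divide_carlitz_L_le[of "b (Suc i)" "Suc i"] unfolding absv_mult absv_power by simp
    then show "\<forall>\<^sub>F i in sequentially. absv (?z i) \<le> M ^ Suc i * absv (b (Suc i))" by simp
  qed simp
  then have z: "?z sums suminf ?z" by (intro summable_sums summable_null_valued)
  define c where "c = b(0 := suminf ?z)"
  have "zeroth_relation \<iota> c" using z by (simp add: zeroth_relation_def c_def)
  moreover have "higher_relations \<pi> \<iota> c" by (rule high) (simp add: c_def)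
  moreover have ca: "\<forall>i\<in>{1..\<delta>}. c i = a i" by (simp add: c_def b_def)
  moreover have "initial_relations \<pi> \<iota> c" using ca by (intro initial_relations_cong[OF init]) simp
  ultimately show ?thesis by blast
qed

definition initial_term :: "(nat \<Rightarrow> 'w) \<Rightarrow> nat \<Rightarrow> 'w" where
  "initial_term c n = (if n = 0 then 1 else (br n * c n) ^ CARD('a))"

definition initial_tuples :: "nat \<Rightarrow> (nat \<Rightarrow> 'w) set" where
  "initial_tuples n =
     {c \<in> {1..n} \<rightarrow>\<^sub>E UNIV. \<forall>i<n. c (Suc i) ^ CARD('a) - c (Suc i) + initial_term c i = 0}"

lemma initial_relations_iff:
  "initial_relations \<pi> \<iota> c \<longleftrightarrow> (\<forall>i<\<delta>. c (Suc i) ^ CARD('a) - c (Suc i) + initial_term c i = 0)"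
proof -
  have "(\<forall>i<\<delta>. P i) \<longleftrightarrow> P 0 \<and> (\<forall>i. 1 \<le> i \<and> i \<le> \<delta> - 1 \<longrightarrow> P i)" for P
    using degree_pi_pos by (metis Suc_pred gr0_conv_Suc less_Suc_eq_le less_one not_less)
  then show ?thesis
    by (simp add: initial_relations_def initial_term_def power_mult_distrib)
qed

lemma initial_tuples_Suc:
  "initial_tuples (Suc n) = (\<lambda>(c, z). c(Suc n := z)) `
     (SIGMA c:initial_tuples n. {z. z ^ CARD('a) - z + initial_term c n = 0})" (is "_ = ?f ` ?carlitz_series")
proof (intro equalityI subsetI)
  fix c assume c: "c \<in> initial_tuples (Suc n)"
  let ?d = "restrict c {1..n}"
  have "initial_term ?d i = initial_term c i" if "i \<le> n" for i
    using that by (simp add: initial_term_def)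
  then have "(?d, c (Suc n)) \<in> ?carlitz_series" using c by (auto simp: initial_tuples_def)
  moreover have "c = ?f (?d, c (Suc n))"
    using c by (auto simp: initial_tuples_def fun_eq_iff PiE_def extensional_def)
  ultimately show "c \<in> ?f ` ?carlitz_series" by (intro image_eqI)
next
  fix c assume "c \<in> ?f ` ?carlitz_series"
  then obtain d z where d: "d \<in> initial_tuples n" "z ^ CARD('a) - z + initial_term d n = 0"
    and c: "c = d(Suc n := z)" by auto
  have "initial_term c i = initial_term d i" if "i \<le> n" for i
    using that by (simp add: initial_term_def c)
  then show "c \<in> initial_tuples (Suc n)"
    using d by (auto simp: initial_tuples_def c PiE_def extensional_def less_Suc_eq)
qed

lemma card_initial_tuples: "finite (initial_tuples n) \<and> card (initial_tuples n) = CARD('a) ^ n"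
proof (induction n)
  case 0
  have "initial_tuples 0 = {\<lambda>_. undefined}" by (auto simp: initial_tuples_def)
  then show ?case by simp
next
  case (Suc n)
  let ?R = "\<lambda>c. {z. z ^ CARD('a) - z + initial_term c n = 0}"
  have fin: "finite (?R c)" for c
    by (rule card_ge_0_finite) (simp add: card_artin_schreier)
  have "inj_on (\<lambda>(c, z). c(Suc n := z)) (SIGMA c:initial_tuples n. ?R c)"
  proof (rule inj_onI, clarify)
    fix c z d y assume cd: "c \<in> initial_tuples n" "d \<in> initial_tuples n"
      and eq: "c(Suc n := z) = d(Suc n := y)"
    have "c i = d i" for i
      using fun_cong[OF eq, of i] cd
      by (cases "i = Suc n") (auto simp: initial_tuples_def PiE_def extensional_def)
    then show "c = d \<and> z = y" using fun_cong[OF eq, of "Suc n"] by auto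
  qed
  then have "card (initial_tuples (Suc n)) = card (SIGMA c:initial_tuples n. ?R c)"
    unfolding initial_tuples_Suc by (rule card_image)
  also have "\<dots> = CARD('a) ^ Suc n"
    using Suc fin by (simp add: card_SigmaI card_artin_schreier)
  finally show ?case
    using Suc fin unfolding initial_tuples_Suc by auto
qed

lemma solutions_classified:
  "card (solutions \<pi> \<iota>) = CARD('a) ^ \<delta> \<and>
    (\<forall>u \<in> solutions \<pi> \<iota>. \<exists>c. carlitz_expansion \<iota> c u \<and>
       initial_relations \<pi> \<iota> c \<and> higher_relations \<pi> \<iota> c \<and> zeroth_relation \<iota> c) \<and>
    (\<forall>a. initial_relations \<pi> \<iota> a \<longrightarrow>
       (\<exists>u \<in> solutions \<pi> \<iota>. \<exists>c. (\<forall>i \<in> {1..\<delta>}. c i = a i) \<and> carlitz_expansion \<iota> c u \<and>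
          higher_relations \<pi> \<iota> c \<and> zeroth_relation \<iota> c))"
proof -
  obtain ext where ext: "\<And>a i. initial_relations \<pi> \<iota> a \<Longrightarrow> i \<in> {1..\<delta>} \<Longrightarrow> ext a i = a i"
    "\<And>a. initial_relations \<pi> \<iota> a \<Longrightarrow> initial_relations \<pi> \<iota> (ext a)"
    "\<And>a. initial_relations \<pi> \<iota> a \<Longrightarrow> higher_relations \<pi> \<iota> (ext a)"
    "\<And>a. initial_relations \<pi> \<iota> a \<Longrightarrow> zeroth_relation \<iota> (ext a)"
    using extend_coefficients by metis
  let ?f = "\<lambda>a. restrict (carlitz_series (ext a)) \<O>" and ?T = "initial_tuples \<delta>"
  have f_sol: "?f a \<in> solutions \<pi> \<iota>" if "initial_relations \<pi> \<iota> a" for a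
    using that by (intro carlitz_series_in_solutions ext)
  have f_exp: "carlitz_expansion \<iota> (ext a) (?f a)" if "initial_relations \<pi> \<iota> a" for a
    using that by (intro carlitz_expansionI coeff_tendsto ext) auto
  have T: "initial_relations \<pi> \<iota> a" if "a \<in> ?T" for a
    using that by (simp add: initial_relations_iff initial_tuples_def)
  have "inj_on ?f ?T"
  proof (rule inj_onI)
    fix a b assume ab: "a \<in> ?T" "b \<in> ?T" and eq: "?f a = ?f b"
    have "carlitz_series (ext a) t = carlitz_series (ext b) t" if "t \<in> \<O>" for t
      using fun_cong[OF eq, of t] that by simp
    then have "ext a = ext b" by (rule carlitz_series_inj)
    then have "a i = b i" if "i \<in> {1..\<delta>}" for i
      using ext(1)[OF T[OF ab(1)] that] ext(1)[OF T[OF ab(2)] that] by simp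
    then show "a = b"
      using ab by (intro PiE_ext[of a "{1..\<delta>}" "\<lambda>_. UNIV" b]) (auto simp: initial_tuples_def)
  qed
  then have card_image: "card (?f ` ?T) = CARD('a) ^ \<delta>"
    using card_initial_tuples[of \<delta>] by (simp add: card_image)
  moreover have sub: "?f ` ?T \<subseteq> solutions \<pi> \<iota>" using f_sol T by blast
  ultimately have card: "card (solutions \<pi> \<iota>) = CARD('a) ^ \<delta>"
    using card_mono[OF finite_solutions sub] card_solutions_le by simp
  have image: "?f ` ?T = solutions \<pi> \<iota>"
    using sub card card_image by (intro card_subset_eq finite_solutions) auto
  have "\<exists>c. carlitz_expansion \<iota> c u \<and> initial_relations \<pi> \<iota> c \<and> higher_relations \<pi> \<iota> c \<and>
      zeroth_relation \<iota> c" if u: "u \<in> solutions \<pi> \<iota>" for u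
  proof -
    obtain a where "a \<in> ?T" and "u = ?f a" using u image by blast
    then show ?thesis using f_exp ext(2-) T by blast
  qed
  moreover have "\<exists>u \<in> solutions \<pi> \<iota>. \<exists>c. (\<forall>i \<in> {1..\<delta>}. c i = a i) \<and> carlitz_expansion \<iota> c u \<and>
      higher_relations \<pi> \<iota> c \<and> zeroth_relation \<iota> c" if "initial_relations \<pi> \<iota> a" for a
    using f_sol[OF that] f_exp[OF that] ext[OF that] by blast
  ultimately show ?thesis using card by blast
qed

end

theorem theorem1:
  fixes \<pi> :: "'a::{field,finite} poly"
    and \<iota> :: "'a poly fract \<Rightarrow> 'w::complete_valued_field"
  assumes "lead_coeff \<pi> = 1" and "irreducible \<pi>"
    and "is_Omega_pi \<pi> \<iota>"
  shows "card (solutions \<pi> \<iota>) = CARD('a) ^ degree \<pi> \<and>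
    (\<forall>u \<in> solutions \<pi> \<iota>. \<exists>c. carlitz_expansion \<iota> c u \<and>
       initial_relations \<pi> \<iota> c \<and> higher_relations \<pi> \<iota> c \<and> zeroth_relation \<iota> c) \<and>
    (\<forall>a. initial_relations \<pi> \<iota> a \<longrightarrow>
       (\<exists>u \<in> solutions \<pi> \<iota>. \<exists>c. (\<forall>i \<in> {1..degree \<pi>}. c i = a i) \<and> carlitz_expansion \<iota> c u \<and>
          higher_relations \<pi> \<iota> c \<and> zeroth_relation \<iota> c))"
proof -
  interpret is_Omega_pi \<pi> \<iota> by fact
  interpret carlitz_setting \<pi> \<iota> using assms by unfold_locales
  show ?thesis by (rule solutions_classified)
qed

end
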